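(* Let $\mathbb{K}=\mathbb{R}$ or $\mathbb{C}$. Let $F,G:(\mathbb{K}^n\times\mathbb{K}^p,0)\to(\mathbb{K},0)$ be smooth germs of the form $F(x,y)=f(x)+Q_f(y)$ and $G(x,y)=g(x)+Q_g(y)$, where $f,g:(\mathbb{K}^n,0)\to(\mathbb{K},0)$ are smooth germs of (finite) multiplicities $m_f,m_g\ge 3$ and $Q_f,Q_g$ are quadratic forms of the form $\pm y_1^2\pm\cdots\pm y_p^2$. If $F$ and $G$ are bi-Lipschitz equivalent, then: (i) $m_f=m_g$; (ii) the singular sets $\Sigma_{H_f}$ and $\Sigma_{H_g}$ are bi-Lipschitz equivalent.
   Context: "Smooth" means $C^\infty$ if $\mathbb{K}=\mathbb{R}$ and holomorphic if $\mathbb{K}=\mathbb{C}$. For a smooth germ $f$ with nonzero Taylor expansion $f_k+f_{k+1}+\cdots$ at $0$ ($f_i$ homogeneous of degree $i$, $f_k\ne0$), $m_f=k$ is the multiplicity of $f$ and $H_f=f_k$ is its lowest degree homogeneous part. For a function $h$ on $\mathbb{K}^n$, $\Sigma_h=\{x\in\mathbb{K}^n: Dh(x)=0\}$. A bi-Lipschitz homeomorphism germ $\varphi:(\mathbb{K}^N,0)\to(\mathbb{K}^N,0)$ is a homeomorphism germ satisfying $\frac1L\|x-y\|\le\|\varphi(x)-\varphi(y)\|\le L\|x-y\|$ near $0$ for some $L>0$. Two function germs $F,G$ are bi-Lipschitz equivalent if $F\circ\varphi=G$ for some such $\varphi$. Two sets $A,B\subset\mathbb{K}^n$ are bi-Lipschitz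 equivalent (as germs at $0$) if there is a germ of bi-Lipschitz homeomorphism $(\mathbb{K}^n,0)\to(\mathbb{K}^n,0)$ mapping the germ of $A$ at $0$ onto the germ of $B$ at $0$. *)

theory Defs
  imports "HOL-Analysis.Analysis"
begin

primrec C_k_on :: "nat \<Rightarrow> ('a::real_normed_vector \<Rightarrow> real) \<Rightarrow> 'a set \<Rightarrow> bool" where
  "C_k_on 0 f U \<longleftrightarrow> continuous_on U f"
| "C_k_on (Suc k) f U \<longleftrightarrow>
     (\<exists>D. (\<forall>x\<in>U. (f has_derivative D x) (at x)) \<and> (\<forall>v. C_k_on k (\<lambda>x. D x v) U))"

text \<open>Germs at the origin are represented by total functions; only the values near 0 matter.\<close>

definition real_smooth_germ :: "(real^'n \<Rightarrow> real) \<Rightarrow> bool" where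
  "real_smooth_germ f \<longleftrightarrow> f 0 = 0 \<and> (\<exists>U. open U \<and> 0 \<in> U \<and> (\<forall>k. C_k_on k f U))"

text \<open>
  In several complex variables \<open>has_derivative\<close> only provides a real-linear derivative, so
  complex homogeneity of the derivative is required separately.
\<close>

definition holomorphic_germ :: "(complex^'n \<Rightarrow> complex) \<Rightarrow> bool" where
  "holomorphic_germ f \<longleftrightarrow> f 0 = 0 \<and>
     (\<exists>U. open U \<and> 0 \<in> U \<and>
       (\<forall>z\<in>U. \<exists>D. (f has_derivative D) (at z) \<and> (\<forall>c v. D (c *s v) = c * D v)))"

text \<open>From here on \<open>'k\<close> stands for \<open>real\<close> or \<open>complex\<close>, and \<open>deriv\<close> is the derivative over \<open>'k\<close>.\<close>

definition partial_deriv ::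
  "'n \<Rightarrow> ('k::real_normed_field^'n \<Rightarrow> 'k) \<Rightarrow> 'k^'n \<Rightarrow> 'k" where
  "partial_deriv j f = (\<lambda>x. deriv (\<lambda>t. f (x + t *s axis j 1)) 0)"

text \<open>
  The homogeneous part of degree \<open>i\<close> of the Taylor expansion at 0. The sum runs over ordered
  index tuples: a multi-index \<open>\<alpha>\<close> of order \<open>i\<close> comes from \<open>i! / \<alpha>!\<close> tuples, so for smooth \<open>f\<close>
  this is the sum of \<open>\<partial>\<^sup>\<alpha> f(0) x\<^sup>\<alpha> / \<alpha>!\<close> over all \<open>\<alpha>\<close> of order \<open>i\<close>.
\<close>

definition taylor_part ::
  "('k::real_normed_field^'n \<Rightarrow> 'k) \<Rightarrow> nat \<Rightarrow> 'k^'n \<Rightarrow> 'k" where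
  "taylor_part f i = (\<lambda>x.
     (\<Sum>js\<in>{js :: 'n list. length js = i}.
        foldr partial_deriv js f 0 * (\<Prod>j\<leftarrow>js. x $ j)) / fact i)"

definition finite_multiplicity :: "('k::real_normed_field^'n \<Rightarrow> 'k) \<Rightarrow> bool" where
  "finite_multiplicity f \<longleftrightarrow> (\<exists>k. taylor_part f k \<noteq> (\<lambda>x. 0))"

text \<open>Only meaningful under \<^const>\<open>finite_multiplicity\<close>.\<close>

definition multiplicity_at_0 :: "('k::real_normed_field^'n \<Rightarrow> 'k) \<Rightarrow> nat" where
  "multiplicity_at_0 f = (LEAST k. taylor_part f k \<noteq> (\<lambda>x. 0))"

definition lowest_part :: "('k::real_normed_field^'n \<Rightarrow> 'k) \<Rightarrow> 'k^'n \<Rightarrow> 'k" where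
  "lowest_part f = taylor_part f (multiplicity_at_0 f)"

text \<open>For complex \<open>h\<close> as well: the zero map is complex linear, so \<open>Dh(x) = 0\<close> means the same over
  both fields.\<close>

definition singular_set :: "('a::real_normed_vector \<Rightarrow> 'b::real_normed_vector) \<Rightarrow> 'a set" where
  "singular_set h = {x. (h has_derivative (\<lambda>v. 0)) (at x)}"

definition signed_sum_of_squares :: "('k::real_normed_field^'p \<Rightarrow> 'k) \<Rightarrow> bool" where
  "signed_sum_of_squares Q \<longleftrightarrow>
     (\<exists>s. (\<forall>i. s i = 1 \<or> s i = - 1) \<and> Q = (\<lambda>y. \<Sum>i\<in>UNIV. s i * (y $ i)\<^sup>2))"

text \<open>
  A representative \<open>\<phi> : U \<rightarrow> V\<close> of a germ of a bi-Lipschitz homeomorphism fixing 0. The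
  neighbourhood \<open>U\<close> may be shrunk freely, so in the two equivalences below identities of germs are
  stated on all of \<open>U\<close> (and \<open>V\<close>).
\<close>

definition bilip_homeo :: "'a::real_normed_vector set \<Rightarrow> 'a set \<Rightarrow> ('a \<Rightarrow> 'a) \<Rightarrow> bool" where
  "bilip_homeo U V \<phi> \<longleftrightarrow>
     open U \<and> open V \<and> 0 \<in> U \<and> \<phi> 0 = 0 \<and> (\<exists>\<psi>. homeomorphism U V \<phi> \<psi>) \<and>
     (\<exists>L>0. \<forall>x\<in>U. \<forall>y\<in>U.
        1 / L * norm (x - y) \<le> norm (\<phi> x - \<phi> y) \<and> norm (\<phi> x - \<phi> y) \<le> L * norm (x - y))"

definition bilip_equiv_fun :: "('a::real_normed_vector \<Rightarrow> 'b) \<Rightarrow> ('a \<Rightarrow> 'b) \<Rightarrow> bool" where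
  "bilip_equiv_fun F G \<longleftrightarrow> (\<exists>\<phi> U V. bilip_homeo U V \<phi> \<and> (\<forall>x\<in>U. F (\<phi> x) = G x))"

definition bilip_equiv_set :: "'a::real_normed_vector set \<Rightarrow> 'a set \<Rightarrow> bool" where
  "bilip_equiv_set A B \<longleftrightarrow> (\<exists>\<phi> U V. bilip_homeo U V \<phi> \<and> \<phi> ` (A \<inter> U) = B \<inter> V)"

end

theory Submission
  imports Defs "HOL-Complex_Analysis.Complex_Analysis"
begin

text \<open>
  If \<open>F \<circ> \<phi> = G\<close> with \<open>\<phi>\<close> bi-Lipschitz, then the norms of the gradients of \<open>F\<close> at \<open>\<phi> z\<close> and of \<open>G\<close> at
  \<open>z\<close> are comparable. Hence \<open>\<phi> (x, 0) = (a x, c x)\<close> with \<open>c x = O(\<parallel>Dg x\<parallel>) = O(\<parallel>x\<parallel>\<^sup>2)\<close>, because the gradient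
  of the quadratic form sees \<open>c x\<close>, and \<open>\<parallel>Df (a x)\<parallel> \<le> L \<parallel>Dg x\<parallel>\<close>. The same holds for \<open>\<phi>\<^sup>-\<^sup>1\<close> with
  a map \<open>b\<close>, and \<open>a\<close>, \<open>b\<close> are inverse to each other up to \<open>O(\<parallel>x\<parallel>\<^sup>2)\<close>. By Arzela--Ascoli the
  rescalings \<open>a (t x) / t\<close>, \<open>b (t x) / t\<close> subconverge to mutually inverse bi-Lipschitz maps \<open>A\<close>, \<open>B\<close>.
  As \<open>Df (t y) / t\<^sup>m\<^sup>-\<^sup>1\<close> tends to the gradient of the lowest part of \<open>f\<close> at \<open>y\<close>, where \<open>m\<close> is the
  multiplicity, unequal multiplicities would make one of the two lowest parts vanish near 0, and for
  equal ones \<open>A\<close> maps the singular set of the lowest part of \<open>g\<close> onto that of \<open>f\<close>.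
\<close>

section \<open>Iterated partial derivatives over the ground field\<close>

text \<open>The obstacle is that \<open>\<phi>\<close> is merely Lipschitz, so there is no chain
  rule. Only increments of the differentiable functions \<open>F\<close> and \<open>G\<close> can be
  compared, which gives bounds on norms of gradients, never identities; but statements about the
  order of vanishing survive such bounds. Multiplicity at least 3 makes \<open>Dg\<close> of order
  two, so the \<open>y\<close>-component and the failure of \<open>a\<close> and \<open>b\<close> to
  be mutually inverse are both \<open>o(\<parallel>x\<parallel>)\<close> and disappear on rescaling;
  gradients of order one would only give \<open>O(\<parallel>x\<parallel>)\<close>. The limits may
  depend on the subsequence, which is harmless since only the existence of a homeomorphism is
  claimed. Real and complex germs are treated together over a type that is both a
  \<open>real_normed_field\<close> and a \<open>euclidean_space\<close>; derivatives are real-linear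
  maps commuting with its scalars. The two fields differ only in the reason why partial derivatives
  of a smooth germ are again differentiable.\<close>

definition field_diff_at :: "('k::{real_normed_field,euclidean_space}^'n \<Rightarrow> 'k) \<Rightarrow> 'k^'n \<Rightarrow> bool" where
  "field_diff_at f z \<longleftrightarrow> (\<exists>D. (f has_derivative D) (at z) \<and> (\<forall>c v. D (c *s v) = c * D v))"

text \<open>Quantifying over all index lists makes the property closed under
  \<open>partial_deriv\<close> and matches the coefficients
  \<open>foldr partial_deriv js f 0\<close> in \<open>taylor_part\<close>. Continuity of the
  iterated partial derivatives is implied, as each of them is differentiable.\<close>

definition field_smooth_on :: "('k::{real_normed_field,euclidean_space}^'n) set \<Rightarrow> ('k^'n \<Rightarrow> 'k) \<Rightarrow> bool" where
  "field_smooth_on U f \<longleftrightarrow> (\<forall>js. \<forall>z\<in>U. field_diff_at (foldr partial_deriv js f) z)"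

abbreviation field_deriv :: "('k::{real_normed_field,euclidean_space}^'n \<Rightarrow> 'k) \<Rightarrow> 'k^'n \<Rightarrow> 'k^'n \<Rightarrow> 'k" where
  "field_deriv f z \<equiv> (\<lambda>v. \<Sum>j\<in>UNIV. v $ j * partial_deriv j f z)"

lemma bounded_linear_vector_scalar_mult_left:
  fixes v :: "'k::{real_normed_field,euclidean_space}^'n"
  shows "bounded_linear (\<lambda>t. t *s v)"
proof -
  have "linear (\<lambda>t. t *s v)"
    by (rule linearI) (auto simp: vec_eq_iff algebra_simps)
  then show ?thesis
    using linear_conv_bounded_linear by blast
qed

lemma norm_axis: "norm (axis i c :: 'k::real_normed_vector^'n) = norm c"
proof -
  have "(\<Sum>j\<in>UNIV. (norm ((axis i c :: 'k^'n) $ j))\<^sup>2) = (\<Sum>j\<in>UNIV. if j = i then (norm c)\<^sup>2 else 0)"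
    by (rule sum.cong) (auto simp: axis_def)
  then show ?thesis by (simp add: norm_vec_def L2_set_def)
qed

lemma has_derivative_line_scalar:
  fixes f :: "'k::{real_normed_field,euclidean_space}^'n \<Rightarrow> 'k"
  assumes "(f has_derivative D) (at (z + a *s v))"
  shows "((\<lambda>t. f (z + t *s v)) has_derivative (\<lambda>t. D (t *s v))) (at a)"
proof -
  have "((\<lambda>t. z + t *s v) has_derivative (\<lambda>t. t *s v)) (at a)"
    by (auto intro!: derivative_eq_intros
        bounded_linear.has_derivative[OF bounded_linear_vector_scalar_mult_left])
  then show ?thesis
    using has_derivative_compose assms by blast
qed

lemma field_diff_at_line:
  fixes f :: "'k::{real_normed_field,euclidean_space}^'n \<Rightarrow> 'k"
  assumes "(f has_derivative D) (at (z + a *s v))" "\<And>c v. D (c *s v) = c * D v"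
  shows "((\<lambda>t. f (z + t *s v)) has_field_derivative D v) (at a)"
  using has_derivative_line_scalar[OF assms(1)] 
  by (simp add: has_field_derivative_def assms(2) mult.commute[of _ "D v"])

lemma field_diff_at_partial:
  fixes f :: "'k::{real_normed_field,euclidean_space}^'n \<Rightarrow> 'k"
  assumes "(f has_derivative D) (at z)" "\<And>c v. D (c *s v) = c * D v"
  shows "partial_deriv j f z = D (axis j 1)"
  unfolding partial_deriv_def
  using field_diff_at_line[of f D z 0 "axis j 1"] assms by (simp add: DERIV_imp_deriv)

lemma sum_vec_axis: "(v::'k::{real_normed_field,euclidean_space}^'n) = (\<Sum>j\<in>UNIV. v $ j *s axis j 1)"
proof -
  have "(\<Sum>j\<in>UNIV. v $ j * axis j 1 $ i) = (\<Sum>j\<in>UNIV. if j = i then v $ j else 0)" for i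
    by (rule sum.cong) (auto simp: axis_def)
  then show ?thesis
    by (simp add: vec_eq_iff)
qed

text \<open>Linearity over the field expresses the derivative through the \<open>n\<close> partial
  derivatives over \<open>'k\<close>; a merely real-linear map on a complex space would need twice
  as many.\<close>

lemma field_diff_at_has_derivative:
  assumes "field_diff_at f z"
  shows "(f has_derivative field_deriv f z) (at z)"
proof -
  obtain D where D: "(f has_derivative D) (at z)" "\<And>c v. D (c *s v) = c * D v"
    using assms unfolding field_diff_at_def by blast
  interpret bounded_linear D using D(1) by (rule has_derivative_bounded_linear)
  have "D v = field_deriv f z v" for v
  proof -
    have "D v = D (\<Sum>j\<in>UNIV. v $ j *s axis j 1)"
      using sum_vec_axis[of v] by (rule arg_cong)
    also have "\<dots> = field_deriv f z v"
      unfolding sum D(2) field_diff_at_partial[OF D] ..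
    finally show ?thesis .
  qed
  then have "D = field_deriv f z" ..
  then show ?thesis using D(1) by (simp only:)
qed

lemma field_diff_at_line_partial:
  assumes "field_diff_at f (z + a *s axis j 1)"
  shows "((\<lambda>t. f (z + t *s axis j 1)) has_field_derivative partial_deriv j f (z + a *s axis j 1)) (at a)"
proof -
  obtain D where D: "(f has_derivative D) (at (z + a *s axis j 1))" "\<And>c v. D (c *s v) = c * D v"
    using assms unfolding field_diff_at_def by blast
  show ?thesis
    unfolding field_diff_at_partial[OF D] by (rule field_diff_at_line[OF D])
qed

lemma field_smooth_onD:
  assumes "field_smooth_on U f" "z \<in> U"
  shows "field_diff_at (foldr partial_deriv js f) z"
  using assms unfolding field_smooth_on_def by blast

lemma field_smooth_on_diff:
  assumes "field_smooth_on U f" "z \<in> U"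
  shows "field_diff_at f z"
  using field_smooth_onD[OF assms, of "[]"] by simp

lemma field_smooth_on_foldr:
  assumes "field_smooth_on U f"
  shows "field_smooth_on U (foldr partial_deriv js f)"
  unfolding field_smooth_on_def
proof (intro allI ballI)
  fix ks z assume "z \<in> U"
  then show "field_diff_at (foldr partial_deriv ks (foldr partial_deriv js f)) z"
    using field_smooth_onD[OF assms, of z "ks @ js"] by simp
qed

lemma field_smooth_on_partial:
  assumes "field_smooth_on U f"
  shows "field_smooth_on U (partial_deriv j f)"
  using field_smooth_on_foldr[OF assms, of "[j]"] by simp

lemma field_smooth_on_continuous:
  assumes "field_smooth_on U f"
  shows "continuous_on U f"
proof (rule continuous_at_imp_continuous_on, rule ballI)
  fix x assume "x \<in> U"
  show "isCont f x"
    by (rule has_derivative_continuous, rule field_diff_at_has_derivative, rule field_smooth_on_diff)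
      fact+
qed

lemma partial_deriv_cong:
  fixes f :: "'k::{real_normed_field,euclidean_space}^'n \<Rightarrow> 'k"
  assumes "open U" "\<And>x. x \<in> U \<Longrightarrow> f x = g x" "x \<in> U"
  shows "partial_deriv j f x = partial_deriv j g x"
  unfolding partial_deriv_def
proof (rule deriv_cong_ev)
  have "isCont (\<lambda>t. x + t *s axis j 1 :: 'k^'n) 0"
    by (intro continuous_intros linear_continuous_at bounded_linear_vector_scalar_mult_left)
  then have "((\<lambda>t. x + t *s axis j 1 :: 'k^'n) \<longlongrightarrow> x + 0 *s axis j 1) (nhds 0)"
    using tendsto_at_iff_tendsto_nhds[of "\<lambda>t. x + t *s axis j 1 :: 'k^'n" 0]
    by (simp only: continuous_at)
  then have "\<forall>\<^sub>F t in nhds 0. x + t *s axis j 1 \<in> U"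
    by (rule topological_tendstoD) (use assms(1,3) in auto)
  then show "\<forall>\<^sub>F t in nhds 0. f (x + t *s axis j 1) = g (x + t *s axis j 1)"
    by eventually_elim (use assms in auto)
qed simp

lemma foldr_partial_deriv_cong:
  fixes f :: "'k::{real_normed_field,euclidean_space}^'n \<Rightarrow> 'k"
  assumes "open U" "\<And>x. x \<in> U \<Longrightarrow> f x = g x" "x \<in> U"
  shows "foldr partial_deriv js f x = foldr partial_deriv js g x"
  using assms(3)
proof (induction js arbitrary: x)
  case (Cons j js)
  have "partial_deriv j (foldr partial_deriv js f) x = partial_deriv j (foldr partial_deriv js g) x"
    by (rule partial_deriv_cong[OF assms(1)]) (use Cons in auto)
  then show ?case by simp
qed (use assms in auto)

section \<open>Symmetry of second derivatives\<close>

lemma second_difference_quotient_tendsto: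
  fixes f :: "'a::real_normed_vector \<Rightarrow> 'b::real_normed_vector"
  assumes "open S" "x \<in> S" and f': "\<And>y. y \<in> S \<Longrightarrow> (f has_derivative f' y) (at y)"
    and D: "((\<lambda>y. f' y u) has_derivative D) (at x)"
  shows "((\<lambda>t. (f (x + t *\<^sub>R u + t *\<^sub>R v) - f (x + t *\<^sub>R u) - f (x + t *\<^sub>R v) + f x) /\<^sub>R t\<^sup>2)
           \<longlongrightarrow> D v) (at_right 0)"
proof (rule tendstoI)
  fix e :: real assume "e > 0"
  interpret D: bounded_linear D using D by (rule has_derivative_bounded_linear)
  define M where "M = norm u + norm v + 1"
  have M: "M > 0" by (simp add: M_def add_nonneg_pos)
  \<comment> \<open>The 8 leaves room for six errors of size \<open>\<eta> * (t * M)\<close>, each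
    multiplied by \<open>t\<close>: four from the variation of \<open>\<psi>'\<close> and two from
    its value at 0.\<close>
  define \<eta> where "\<eta> = e / (8 * M)"
  have \<eta>: "\<eta> > 0" using \<open>e > 0\<close> M by (simp add: \<eta>_def)
  obtain d where d: "d > 0"
    "\<And>y. norm (y - x) < d \<Longrightarrow> norm (f' y u - f' x u - D (y - x)) \<le> \<eta> * norm (y - x)"
    using D \<eta> unfolding has_derivative_at_alt by blast
  obtain r where r: "r > 0" "ball x r \<subseteq> S"
    using assms(1,2) openE by blast
  define \<delta> where "\<delta> = min d r / M"
  have "\<delta> > 0" using d(1) r(1) M by (simp add: \<delta>_def)
  have *: "dist ((f (x + t *\<^sub>R u + t *\<^sub>R v) - f (x + t *\<^sub>R u) - f (x + t *\<^sub>R v) + f x) /\<^sub>R t\<^sup>2) (D v) < e"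
    if t: "0 < t" "t < \<delta>" for t
  proof -
    define E where "E w = f' (x + w) u - f' x u - D w" for w
    have small: "norm (s *\<^sub>R u + \<tau> *\<^sub>R v) \<le> t * M" if "0 \<le> s" "s \<le> t" "0 \<le> \<tau>" "\<tau> \<le> t" for s \<tau>
    proof -
      have "norm (s *\<^sub>R u + \<tau> *\<^sub>R v) \<le> s * norm u + \<tau> * norm v"
        using norm_triangle_ineq[of "s *\<^sub>R u" "\<tau> *\<^sub>R v"] that by simp
      also have "\<dots> \<le> t * norm u + t * norm v"
        using that by (intro add_mono mult_right_mono) auto
      also have "\<dots> \<le> t * M" using t by (simp add: M_def algebra_simps)
      finally show ?thesis .
    qed
    have tM: "t * M < min d r" using t M by (simp add: \<delta>_def pos_less_divide_eq)
    have E: "norm (E (s *\<^sub>R u + \<tau> *\<^sub>R v)) \<le> \<eta> * (t * M)" if "0 \<le> s" "s \<le> t" "0 \<le> \<tau>" "\<tau> \<le> t" for s \<tau>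
    proof -
      have "norm (E (s *\<^sub>R u + \<tau> *\<^sub>R v)) \<le> \<eta> * norm (s *\<^sub>R u + \<tau> *\<^sub>R v)"
        using d(2)[of "x + (s *\<^sub>R u + \<tau> *\<^sub>R v)"] small[OF that] tM by (simp add: E_def)
      also have "\<dots> \<le> \<eta> * (t * M)"
        using small[OF that] \<eta> by (intro mult_left_mono) auto
      finally show ?thesis .
    qed
    have inS: "x + s *\<^sub>R u + \<tau> *\<^sub>R v \<in> S" if "0 \<le> s" "s \<le> t" "0 \<le> \<tau>" "\<tau> \<le> t" for s \<tau>
    proof -
      have "dist x (x + s *\<^sub>R u + \<tau> *\<^sub>R v) = norm (s *\<^sub>R u + \<tau> *\<^sub>R v)"
        by (metis add.assoc dist_norm norm_minus_commute add_diff_cancel_left')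
      then show ?thesis using small[OF that] tM r(2) by (auto simp: subset_iff)
    qed
    \<comment> \<open>The second difference is \<open>\<psi> t - \<psi> 0\<close>, and
      \<open>\<psi>'\<close> is a difference of two values of \<open>\<lambda>y. f' y u\<close>,
      both expanded at \<open>x\<close> by means of \<open>D\<close>. Differentiability of that map
      at the single point \<open>x\<close> therefore suffices.\<close>
    define \<psi> where "\<psi> s = f (x + s *\<^sub>R u + t *\<^sub>R v) - f (x + s *\<^sub>R u)" for s
    define \<psi>' where "\<psi>' s = f' (x + s *\<^sub>R u + t *\<^sub>R v) u - f' (x + s *\<^sub>R u) u" for s
    have der: "(\<psi> has_vector_derivative \<psi>' s) (at s within {0..t})" if "s \<in> {0..t}" for s
    proof -
      have in1: "x + s *\<^sub>R u + t *\<^sub>R v \<in> S" and in2: "x + s *\<^sub>R u \<in> S"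
        using inS[of s t] inS[of s 0] that t by auto
      have 1: "((\<lambda>s. f (x + s *\<^sub>R u + t *\<^sub>R v)) has_derivative (\<lambda>h. f' (x + s *\<^sub>R u + t *\<^sub>R v) (h *\<^sub>R u))) (at s)"
        by (rule has_derivative_compose[of "\<lambda>s. x + s *\<^sub>R u + t *\<^sub>R v", OF _ f'[OF in1]]) (auto intro!: derivative_eq_intros)
      have 2: "((\<lambda>s. f (x + s *\<^sub>R u)) has_derivative (\<lambda>h. f' (x + s *\<^sub>R u) (h *\<^sub>R u))) (at s)"
        by (rule has_derivative_compose[of "\<lambda>s. x + s *\<^sub>R u", OF _ f'[OF in2]]) (auto intro!: derivative_eq_intros)
      have l1: "linear (f' (x + s *\<^sub>R u + t *\<^sub>R v))" "linear (f' (x + s *\<^sub>R u))"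
        using f'[OF in1] f'[OF in2] has_derivative_linear by blast+
      have "(\<psi> has_derivative (\<lambda>h. f' (x + s *\<^sub>R u + t *\<^sub>R v) (h *\<^sub>R u) - f' (x + s *\<^sub>R u) (h *\<^sub>R u))) (at s)"
        unfolding \<psi>_def by (rule has_derivative_diff[OF 1 2])
      then have "(\<psi> has_derivative (\<lambda>h. h *\<^sub>R \<psi>' s)) (at s)"
        by (simp add: \<psi>'_def linear_cmul[OF l1(1)] linear_cmul[OF l1(2)] scaleR_right_diff_distrib)
      then show ?thesis
        unfolding has_vector_derivative_def by (rule has_derivative_at_withinI)
    qed
    have psiE: "\<psi>' s = D (t *\<^sub>R v) + E (s *\<^sub>R u + t *\<^sub>R v) - E (s *\<^sub>R u + 0 *\<^sub>R v)" for s
      by (simp add: \<psi>'_def E_def D.add algebra_simps)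
    have bnd: "norm (\<psi>' s - \<psi>' 0) \<le> 4 * (\<eta> * (t * M))" if "s \<in> {0..t}" for s
    proof -
      have eq: "\<psi>' s - \<psi>' 0 = (E (s *\<^sub>R u + t *\<^sub>R v) - E (s *\<^sub>R u + 0 *\<^sub>R v)) 
        - (E (0 *\<^sub>R u + t *\<^sub>R v) - E (0 *\<^sub>R u + 0 *\<^sub>R v))"
        unfolding psiE by (simp add: algebra_simps)
      show ?thesis unfolding eq
        using E[of s t] E[of s 0] E[of 0 t] E[of 0 0] that t
        by (intro norm_triangle_le_diff order.trans[OF add_mono[OF norm_triangle_ineq4 norm_triangle_ineq4]]) auto
    qed
    have A: "norm (\<psi> t - \<psi> 0 - (t - 0) *\<^sub>R \<psi>' 0) \<le> norm (t - 0) * (4 * (\<eta> * (t * M)))"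
      by (rule vector_differentiable_bound_linearization[where S="{0..t}"])
        (use der bnd t in \<open>auto simp: closed_segment_eq_real_ivl\<close>)
    have B: "norm (\<psi>' 0 - t *\<^sub>R D v) \<le> 2 * (\<eta> * (t * M))"
      unfolding psiE using E[of 0 t] E[of 0 0] t norm_triangle_ineq4[of "E (0 *\<^sub>R u + t *\<^sub>R v)" "E (0 *\<^sub>R u + 0 *\<^sub>R v)"]
      by (simp add: D.scaleR)
    have "norm (\<psi> t - \<psi> 0 - t\<^sup>2 *\<^sub>R D v) \<le> norm (\<psi> t - \<psi> 0 - t *\<^sub>R \<psi>' 0) + norm (t *\<^sub>R (\<psi>' 0 - t *\<^sub>R D v))"
      using norm_triangle_ineq[of "\<psi> t - \<psi> 0 - t *\<^sub>R \<psi>' 0" "t *\<^sub>R (\<psi>' 0 - t *\<^sub>R D v)"]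
      by (simp add: algebra_simps power2_eq_square)
    also have "\<dots> \<le> t * (4 * (\<eta> * (t * M))) + t * (2 * (\<eta> * (t * M)))"
      using A B t by (intro add_mono) auto
    also have "\<dots> = t\<^sup>2 * (6 / 8 * e)"
      using M by (simp add: \<eta>_def power2_eq_square field_simps)
    finally have C: "norm (\<psi> t - \<psi> 0 - t\<^sup>2 *\<^sub>R D v) \<le> t\<^sup>2 * (6 / 8 * e)" .
    have "(\<psi> t - \<psi> 0) /\<^sub>R t\<^sup>2 - D v = (\<psi> t - \<psi> 0 - t\<^sup>2 *\<^sub>R D v) /\<^sub>R t\<^sup>2"
      using t by (simp add: scaleR_right_diff_distrib)
    then have "norm ((\<psi> t - \<psi> 0) /\<^sub>R t\<^sup>2 - D v) = norm (\<psi> t - \<psi> 0 - t\<^sup>2 *\<^sub>R D v) / t\<^sup>2"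
      by (simp add: divide_inverse_commute)
    also have "\<dots> \<le> 6 / 8 * e"
      using C t by (simp add: pos_divide_le_eq mult.commute)
    also have "\<dots> < e" using \<open>e > 0\<close> by simp
    finally show ?thesis
      by (simp add: dist_norm \<psi>_def algebra_simps)
  qed
  show "\<forall>\<^sub>F t in at_right 0. dist ((f (x + t *\<^sub>R u + t *\<^sub>R v) - f (x + t *\<^sub>R u) - f (x + t *\<^sub>R v) + f x) /\<^sub>R t\<^sup>2) (D v) < e"
    using * \<open>\<delta> > 0\<close> by (auto simp: eventually_at_right_field intro!: exI[of _ \<delta>])
qed

text \<open>The second difference is unchanged when \<open>u\<close> and \<open>v\<close> are
  interchanged, so the limit of its quotient computes both mixed derivatives.\<close>

lemma second_derivative_symmetric:
  fixes f :: "'a::real_normed_vector \<Rightarrow> 'b::real_normed_vector"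
  assumes "open S" "x \<in> S" "\<And>y. y \<in> S \<Longrightarrow> (f has_derivative f' y) (at y)"
    and Du: "((\<lambda>y. f' y u) has_derivative Du) (at x)"
    and Dv: "((\<lambda>y. f' y v) has_derivative Dv) (at x)"
  shows "Du v = Dv u"
proof (rule tendsto_unique)
  show "((\<lambda>t. (f (x + t *\<^sub>R u + t *\<^sub>R v) - f (x + t *\<^sub>R u) - f (x + t *\<^sub>R v) + f x) /\<^sub>R t\<^sup>2)
           \<longlongrightarrow> Du v) (at_right 0)"
    by (rule second_difference_quotient_tendsto[OF assms(1-3) Du])
  show "((\<lambda>t. (f (x + t *\<^sub>R u + t *\<^sub>R v) - f (x + t *\<^sub>R u) - f (x + t *\<^sub>R v) + f x) /\<^sub>R t\<^sup>2)
           \<longlongrightarrow> Dv u) (at_right 0)"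
    using second_difference_quotient_tendsto[OF assms(1-3) Dv, of u]
    by (simp add: algebra_simps)
qed simp

lemma field_deriv_axis: "field_deriv f z (axis k 1) = partial_deriv k f z"
proof -
  have "field_deriv f z (axis k 1) = (\<Sum>j\<in>UNIV. if j = k then partial_deriv j f z else 0)"
    by (rule sum.cong) (auto simp: axis_def)
  then show ?thesis by simp
qed

lemma partial_deriv_commute:
  fixes f :: "'k::{real_normed_field,euclidean_space}^'n \<Rightarrow> 'k"
  assumes "open U" "field_smooth_on U f" "x \<in> U"
  shows "partial_deriv j (partial_deriv k f) x = partial_deriv k (partial_deriv j f) x"
proof -
  have pd: "((\<lambda>y. field_deriv f y (axis i 1)) has_derivative field_deriv (partial_deriv i f) x) (at x)" for i
    unfolding field_deriv_axis
    using field_diff_at_has_derivative[OF field_smooth_on_diff[OF field_smooth_on_partial]] assms(2,3) by blast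
  have "field_deriv (partial_deriv k f) x (axis j 1) = field_deriv (partial_deriv j f) x (axis k 1)"
    by (rule second_derivative_symmetric[where f' = "field_deriv f", OF assms(1,3) _ pd pd])
      (rule field_diff_at_has_derivative[OF field_smooth_on_diff[OF assms(2)]])
  then show ?thesis unfolding field_deriv_axis .
qed

text \<open>The interchange of two derivatives holds on all of the open set \<open>U\<close>, and it
  is this equality of functions near \<open>x\<close> that passes through the outer derivatives
  \<open>as\<close>.\<close>

lemma foldr_partial_deriv_swap:
  fixes f :: "'k::{real_normed_field,euclidean_space}^'n \<Rightarrow> 'k"
  assumes "open U" "field_smooth_on U f" "x \<in> U"
  shows "foldr partial_deriv (as @ j # k # bs) f x = foldr partial_deriv (as @ k # j # bs) f x"
  using foldr_partial_deriv_cong[OF assms(1) _ assms(3), of "foldr partial_deriv (j # k # bs) f" "foldr partial_deriv (k # j # bs) f" as]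
    partial_deriv_commute[OF assms(1) field_smooth_on_foldr[OF assms(2)]]
  by simp

section \<open>Homogeneous polynomials and Taylor expansion\<close>

text \<open>A form of degree \<open>i\<close> given by a coefficient tensor on ordered index tuples
  instead of multi-indices: the first index can then be peeled off, which drives the inductions on
  the degree.\<close>

definition multi_sum :: "nat \<Rightarrow> ('n::finite list \<Rightarrow> 'k::comm_semiring_1) \<Rightarrow> 'k^'n \<Rightarrow> 'k" where
  "multi_sum i c x = (\<Sum>js\<in>{js. length js = i}. c js * (\<Prod>j\<leftarrow>js. x $ j))"

lemma taylor_part_multi_sum:
  "taylor_part f i x = multi_sum i (\<lambda>js. foldr partial_deriv js f 0) x / fact i"
  by (simp add: taylor_part_def multi_sum_def)

lemma multi_sum_0 [simp]: "multi_sum 0 c x = c []"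
  by (simp add: multi_sum_def)

lemma sum_lists_Suc:
  fixes F :: "'n::finite list \<Rightarrow> 'k::comm_monoid_add"
  shows "(\<Sum>js\<in>{js. length js = Suc i}. F js) = (\<Sum>j\<in>UNIV. \<Sum>js\<in>{js. length js = i}. F (j # js))"
proof -
  have fin: "finite {js :: 'n list. length js = i}"
    using finite_lists_length_eq[of "UNIV :: 'n set" i] by simp
  have eq: "{js :: 'n list. length js = Suc i} = (\<lambda>(j, js). j # js) ` (UNIV \<times> {js. length js = i})"
    by (auto simp: length_Suc_conv image_iff)
  have "(\<Sum>js\<in>{js. length js = Suc i}. F js) = (\<Sum>(j, js)\<in>UNIV \<times> {js. length js = i}. F (j # js))"
    unfolding eq by (subst sum.reindex) (auto simp: inj_on_def case_prod_unfold)
  then show ?thesis by (simp add: sum.cartesian_product)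
qed

lemma multi_sum_Suc:
  "multi_sum (Suc i) c x = (\<Sum>j\<in>UNIV. x $ j * multi_sum i (\<lambda>js. c (j # js)) x)"
  unfolding multi_sum_def sum_lists_Suc by (simp add: sum_distrib_left mult_ac)

lemma multi_sum_scale:
  "multi_sum i c (s *s x) = s ^ i * multi_sum i c x"
proof (induction i arbitrary: c)
  case (Suc i)
  then show ?case by (simp add: multi_sum_Suc sum_distrib_left mult_ac)
qed simp

lemma continuous_on_multi_sum [continuous_intros]:
  fixes c :: "'n::finite list \<Rightarrow> 'k::{real_normed_field,euclidean_space}"
  shows "continuous_on S (multi_sum i c)"
proof (induction i arbitrary: c)
  case 0
  then show ?case by (simp add: multi_sum_def)
next
  case (Suc i)
  have "multi_sum (Suc i) c = (\<lambda>x. \<Sum>j\<in>UNIV. x $ j * multi_sum i (\<lambda>js. c (j # js)) x)"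
    by (rule ext) (rule multi_sum_Suc)
  then show ?case using Suc by (auto intro!: continuous_intros)
qed

text \<open>Swapping adjacent entries generates all permutations, so this is full symmetry of the
  coefficient tensor.\<close>

definition symmetric_coeffs :: "('n list \<Rightarrow> 'k) \<Rightarrow> bool" where
  "symmetric_coeffs c \<longleftrightarrow> (\<forall>as j k bs. c (as @ j # k # bs) = c (as @ k # j # bs))"

lemma symmetric_coeffs_Cons:
  assumes "symmetric_coeffs c"
  shows "symmetric_coeffs (\<lambda>js. c (j # js))"
  unfolding symmetric_coeffs_def
proof (intro allI)
  fix as k l bs
  show "c (j # as @ k # l # bs) = c (j # as @ l # k # bs)"
    using assms[unfolded symmetric_coeffs_def, rule_format, of "j # as" k l bs] by simp
qed

text \<open>\<open>foldr\<close> applies the head of a list last, so the Taylor coefficients of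
  \<open>partial_deriv j f\<close> belong to the lists \<open>js @ [j]\<close>, whereas
  differentiating a form peels indices off the front. Symmetry reconciles the two orders.\<close>

lemma symmetric_coeffs_rotate:
  assumes "symmetric_coeffs c"
  shows "c (js @ [j]) = c (j # js)"
  using assms
proof (induction js arbitrary: c)
  case (Cons k js)
  have "c ((k # js) @ [j]) = c (k # j # js)"
    using Cons.IH[OF symmetric_coeffs_Cons[OF Cons.prems, of k]] by simp
  also have "\<dots> = c (j # k # js)"
    using Cons.prems[unfolded symmetric_coeffs_def, rule_format, of "[]" k j js] by simp
  finally show ?case .
qed simp

text \<open>Every slot of a symmetric tensor contributes the same amount. In the step to degree
  \<open>Suc (Suc i)\<close> the product rule gives one copy from the leading factor
  \<open>x $ j\<close> and, after interchanging the first two indices, \<open>Suc i\<close> copies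
  from the remaining form.\<close>

lemma multi_sum_has_derivative:
  fixes c :: "'n::finite list \<Rightarrow> 'k::{real_normed_field,euclidean_space}"
  assumes "symmetric_coeffs c"
  shows "(multi_sum (Suc i) c has_derivative
           (\<lambda>v. of_nat (Suc i) * (\<Sum>j\<in>UNIV. v $ j * multi_sum i (\<lambda>js. c (j # js)) x))) (at x)"
  using assms
proof (induction i arbitrary: c)
  case 0
  have "multi_sum (Suc 0) c = (\<lambda>x. \<Sum>j\<in>UNIV. x $ j * c [j])"
    by (rule ext) (simp add: multi_sum_Suc)
  then show ?case
    by (auto intro!: derivative_eq_intros bounded_linear.has_derivative[OF bounded_linear_vec_nth])
next
  case (Suc i)
  let ?c = "\<lambda>j js. c (j # js)"
  have eq: "multi_sum (Suc (Suc i)) c = (\<lambda>x. \<Sum>j\<in>UNIV. x $ j * multi_sum (Suc i) (?c j) x)"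
    by (rule ext) (rule multi_sum_Suc)
  have IH: "(multi_sum (Suc i) (?c j) has_derivative
      (\<lambda>v. of_nat (Suc i) * (\<Sum>k\<in>UNIV. v $ k * multi_sum i (\<lambda>js. c (j # k # js)) x))) (at x)" for j
    by (rule Suc.IH[OF symmetric_coeffs_Cons[OF Suc.prems]])
  have vn: "((\<lambda>x. x $ j) has_derivative (\<lambda>v. v $ j)) (at (x::'k^'n))" for j
    by (rule bounded_linear.has_derivative[OF bounded_linear_vec_nth has_derivative_ident])
  have der: "(multi_sum (Suc (Suc i)) c has_derivative (\<lambda>v. \<Sum>j\<in>UNIV.
      x $ j * (of_nat (Suc i) * (\<Sum>k\<in>UNIV. v $ k * multi_sum i (\<lambda>js. c (j # k # js)) x))
        + v $ j * multi_sum (Suc i) (?c j) x)) (at x)"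
    unfolding eq by (rule has_derivative_sum) (rule has_derivative_mult[OF vn IH])
  have swap: "c (j # k # js) = c (k # j # js)" for j k js
    using Suc.prems[unfolded symmetric_coeffs_def, rule_format, of "[]" j k js] by simp
  have "(\<Sum>j\<in>UNIV. x $ j * (of_nat (Suc i) * (\<Sum>k\<in>UNIV. v $ k * multi_sum i (\<lambda>js. c (j # k # js)) x)))
      = of_nat (Suc i) * (\<Sum>k\<in>UNIV. v $ k * multi_sum (Suc i) (?c k) x)" for v
  proof -
    have "(\<Sum>j\<in>UNIV. x $ j * (of_nat (Suc i) * (\<Sum>k\<in>UNIV. v $ k * multi_sum i (\<lambda>js. c (j # k # js)) x)))
      = (\<Sum>j\<in>UNIV. \<Sum>k\<in>UNIV. of_nat (Suc i) * (v $ k * (x $ j * multi_sum i (\<lambda>js. c (k # j # js)) x)))"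
      unfolding swap[of _ _] sum_distrib_left by (simp only: mult_ac)
    also have "\<dots> = (\<Sum>k\<in>UNIV. \<Sum>j\<in>UNIV. of_nat (Suc i) * (v $ k * (x $ j * multi_sum i (\<lambda>js. c (k # j # js)) x)))"
      by (rule sum.swap)
    also have "\<dots> = of_nat (Suc i) * (\<Sum>k\<in>UNIV. v $ k * multi_sum (Suc i) (?c k) x)"
      unfolding multi_sum_Suc sum_distrib_left by (simp only: mult_ac)
    finally show ?thesis .
  qed
  then have "(\<lambda>v. \<Sum>j\<in>UNIV.
      x $ j * (of_nat (Suc i) * (\<Sum>k\<in>UNIV. v $ k * multi_sum i (\<lambda>js. c (j # k # js)) x))
        + v $ j * multi_sum (Suc i) (?c j) x)
     = (\<lambda>v. of_nat (Suc (Suc i)) * (\<Sum>j\<in>UNIV. v $ j * multi_sum (Suc i) (?c j) x))"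
    by (intro ext) (simp only: sum.distrib of_nat_Suc distrib_right mult_1 add.commute)
  with der show ?case by (simp only:)
qed

section \<open>Norm bounds and the Taylor remainder\<close>

lemma norm_vec_nth_le:
  fixes x :: "'k::real_normed_vector^'n"
  shows "norm (x $ j) \<le> norm x"
  unfolding norm_vec_def by (rule member_le_L2_set) auto

lemma norm_prod_list_le:
  fixes x :: "'k::{real_normed_field,euclidean_space}^'n"
  shows "norm (\<Prod>j\<leftarrow>js. x $ j) \<le> norm x ^ length js"
proof (induction js)
  case (Cons j js)
  then show ?case
    using mult_mono[OF norm_vec_nth_le[of x j] Cons] by (simp add: norm_mult)
qed simp

lemma norm_multi_sum_le:
  fixes x :: "'k::{real_normed_field,euclidean_space}^'n"
  assumes "\<And>js. length js = i \<Longrightarrow> norm (c js) \<le> K js"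
  shows "norm (multi_sum i c x) \<le> (\<Sum>js\<in>{js. length js = i}. K js) * norm x ^ i"
proof -
  have "norm (multi_sum i c x) \<le> (\<Sum>js\<in>{js. length js = i}. K js * norm x ^ i)"
    unfolding multi_sum_def
  proof (rule sum_norm_le)
    fix js :: "'n list" assume "js \<in> {js. length js = i}"
    then have "length js = i" by simp
    then have "norm (c js) * norm (\<Prod>j\<leftarrow>js. x $ j) \<le> K js * norm x ^ i"
      using norm_prod_list_le[of x js] assms[of js] order_trans[OF norm_ge_zero assms[of js]]
      by (intro mult_mono) auto
    then show "norm (c js * (\<Prod>j\<leftarrow>js. x $ j)) \<le> K js * norm x ^ i"
      by (simp only: norm_mult)
  qed
  then show ?thesis by (simp add: sum_distrib_right)
qed

lemma scaleR_eq_vector_scalar_mult: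
  fixes x :: "'k::{real_normed_field,euclidean_space}^'n"
  shows "t *\<^sub>R x = of_real t *s x"
  by (simp add: vec_eq_iff scaleR_conv_of_real[where 'a='k])

lemma taylor_part_scaleR: 
  fixes x :: "'k::{real_normed_field,euclidean_space}^'n"
  shows "taylor_part f i (t *\<^sub>R x) = t ^ i *\<^sub>R taylor_part f i x"
  by (simp add: taylor_part_multi_sum scaleR_eq_vector_scalar_mult multi_sum_scale scaleR_conv_of_real[where 'a='k])

text \<open>Differentiating along the ray puts one new index in front of each tuple. By iteration
  the \<open>i\<close>-th derivative of \<open>\<lambda>t. f (t *\<^sub>R y)\<close> is a form of
  degree \<open>i\<close> in \<open>y\<close>, ready for Taylor's formula in one variable.\<close>

lemma multi_derivative_along_line:
  fixes f :: "'k::{real_normed_field,euclidean_space}^'n \<Rightarrow> 'k"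
  assumes "field_smooth_on U f" "t *\<^sub>R y \<in> U"
  shows "((\<lambda>t. multi_sum i (\<lambda>js. foldr partial_deriv js f (t *\<^sub>R y)) y) has_vector_derivative
           multi_sum (Suc i) (\<lambda>js. foldr partial_deriv js f (t *\<^sub>R y)) y) (at t)"
proof -
  have "((\<lambda>t. foldr partial_deriv js f (t *\<^sub>R y)) has_derivative
      (\<lambda>h. field_deriv (foldr partial_deriv js f) (t *\<^sub>R y) (h *\<^sub>R y))) (at t)" for js
    by (rule has_derivative_compose[of "\<lambda>t. t *\<^sub>R y", OF _ field_diff_at_has_derivative[OF field_smooth_onD[OF assms]]])
      (auto intro!: derivative_eq_intros)
  moreover have "field_deriv (foldr partial_deriv js f) (t *\<^sub>R y) (h *\<^sub>R y)
      = h *\<^sub>R (\<Sum>j\<in>UNIV. y $ j * foldr partial_deriv (j # js) f (t *\<^sub>R y))" for js h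
    by (simp add: scaleR_sum_right)
  ultimately have *: "((\<lambda>t. foldr partial_deriv js f (t *\<^sub>R y)) has_vector_derivative
      (\<Sum>j\<in>UNIV. y $ j * foldr partial_deriv (j # js) f (t *\<^sub>R y))) (at t)" for js
    unfolding has_vector_derivative_def by simp
  have "((\<lambda>t. multi_sum i (\<lambda>js. foldr partial_deriv js f (t *\<^sub>R y)) y) has_vector_derivative
      (\<Sum>js\<in>{js. length js = i}. (\<Sum>j\<in>UNIV. y $ j * foldr partial_deriv (j # js) f (t *\<^sub>R y)) * (\<Prod>j\<leftarrow>js. y $ j))) (at t)"
    unfolding multi_sum_def
    by (intro has_vector_derivative_sum has_vector_derivative_mult_left *)
  also have "(\<Sum>js\<in>{js. length js = i}. (\<Sum>j\<in>UNIV. y $ j * foldr partial_deriv (j # js) f (t *\<^sub>R y)) * (\<Prod>j\<leftarrow>js. y $ j))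
     = multi_sum (Suc i) (\<lambda>js. foldr partial_deriv js f (t *\<^sub>R y)) y"
    unfolding multi_sum_def sum_lists_Suc sum_distrib_right
    by (subst sum.swap) (simp add: mult_ac)
  finally show ?thesis .
qed

text \<open>The formula with integral remainder is used on the segment from 0 to \<open>y\<close>.
  The derivative in the remainder is a form of degree \<open>p\<close> in \<open>y\<close> whose
  coefficients are bounded on a compact ball, which yields \<open>norm y ^ p\<close> with a uniform
  constant.\<close>

lemma taylor_remainder_bound:
  fixes f :: "'k::{real_normed_field,euclidean_space}^'n \<Rightarrow> 'k"
  assumes "open U" "field_smooth_on U f" "0 \<in> U" "p > 0"
  shows "\<exists>r>0. \<exists>C. \<forall>y. norm y < r \<longrightarrow> norm (f y - (\<Sum>i<p. taylor_part f i y)) \<le> C * norm y ^ p"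
proof -
  obtain r where r: "r > 0" "cball 0 r \<subseteq> U"
    using assms(1,3) open_contains_cball by blast
  have "\<exists>K. \<forall>z\<in>cball 0 r. norm (foldr partial_deriv js f z) \<le> K" for js
  proof -
    have "continuous_on (cball 0 r) (foldr partial_deriv js f)"
      using field_smooth_on_continuous[OF field_smooth_on_foldr[OF assms(2)]] r(2) continuous_on_subset by blast
    then have "bounded (foldr partial_deriv js f ` cball 0 r)"
      by (intro compact_imp_bounded compact_continuous_image) auto
    then show ?thesis unfolding bounded_iff by blast
  qed
  then obtain K where K: "\<And>js z. z \<in> cball 0 r \<Longrightarrow> norm (foldr partial_deriv js f z) \<le> K js"
    by metis
  define C where "C = (\<Sum>js\<in>{js :: 'n list. length js = p}. K js)"
  have "norm (f y - (\<Sum>i<p. taylor_part f i y)) \<le> C * norm y ^ p" if y: "norm y < r" for y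
  proof -
    define Df where "Df i t = multi_sum i (\<lambda>js. foldr partial_deriv js f (t *\<^sub>R y)) y" for i and t :: real
    have seg: "t *\<^sub>R y \<in> cball 0 r" if "0 \<le> t" "t \<le> 1" for t
      using that y mult_left_le_one_le[of "norm y" t] by simp
    have bnd: "norm (Df p t) \<le> C * norm y ^ p" if "0 \<le> t" "t \<le> 1" for t
      unfolding Df_def C_def by (rule norm_multi_sum_le) (rule K[OF seg[OF that]])
    have "((\<lambda>x. ((1 - x) ^ (p - 1) / fact (p - 1)) *\<^sub>R Df p x) has_integral
        Df 0 1 - (\<Sum>i<p. ((1 - 0) ^ i / fact i) *\<^sub>R Df i 0)) {0..1}"
      by (rule Taylor_has_integral[OF assms(4)])
        (auto simp: Df_def intro!: has_vector_derivative_at_within multi_derivative_along_line[OF assms(2)] subsetD[OF r(2) seg])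
    then have "((\<lambda>x. ((1 - x) ^ (p - 1) / fact (p - 1)) *\<^sub>R Df p x) has_integral
        f y - (\<Sum>i<p. taylor_part f i y)) {0..1}"
      by (simp add: Df_def taylor_part_multi_sum scaleR_conv_of_real[where 'a='k] divide_inverse mult.commute)
    then have int: "((\<lambda>x. ((1 - x) ^ (p - 1) / fact (p - 1)) *\<^sub>R Df p x) has_integral
        f y - (\<Sum>i<p. taylor_part f i y)) (cbox 0 1)"
      by simp
    have nn: "0 \<le> C * norm y ^ p"
      using bnd[of 0] order_trans[OF norm_ge_zero] by (metis zero_le_one order_refl)
    have "norm (f y - (\<Sum>i<p. taylor_part f i y)) \<le> C * norm y ^ p * measure lborel (cbox 0 (1::real))"
    proof (rule has_integral_bound[OF nn int])
      fix x :: real assume "x \<in> cbox 0 1"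
      then have x: "0 \<le> x" "x \<le> 1" by auto
      have "(1 - x) ^ (p - 1) / fact (p - 1) \<le> 1"
        using order_trans[OF power_le_one fact_ge_1, of "1 - x" "p - 1" "p - 1"] x by simp
      moreover have "0 \<le> (1 - x) ^ (p - 1) / fact (p - 1)" using x by simp
      ultimately show "norm (((1 - x) ^ (p - 1) / fact (p - 1)) *\<^sub>R Df p x) \<le> C * norm y ^ p"
        using bnd[OF x] mult_mono[of "(1 - x) ^ (p - 1) / fact (p - 1)" 1 "norm (Df p x)" "C * norm y ^ p"]
        by (simp only: norm_scaleR abs_of_nonneg norm_ge_zero mult_1 zero_le_one)
    qed
    then show ?thesis by simp
  qed
  then show ?thesis using r(1) by blast
qed

text \<open>The factor \<open>Suc i\<close> from differentiating the form cancels against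
  \<open>fact (Suc i)\<close>, so taking homogeneous parts commutes with differentiation up to the
  drop in degree. Expansions of the partial derivatives can thus be read off from the parts of
  \<open>f\<close>.\<close>

lemma taylor_part_has_derivative:
  fixes f :: "'k::{real_normed_field,euclidean_space}^'n \<Rightarrow> 'k"
  assumes "open U" "field_smooth_on U f" "0 \<in> U"
  shows "(taylor_part f (Suc i) has_derivative
           (\<lambda>v. \<Sum>j\<in>UNIV. v $ j * taylor_part (partial_deriv j f) i x)) (at x)"
proof -
  define c where "c js = foldr partial_deriv js f 0" for js
  have sym: "symmetric_coeffs c"
    unfolding symmetric_coeffs_def c_def using foldr_partial_deriv_swap[OF assms] by blast
  have c: "c (j # js) = foldr partial_deriv js (partial_deriv j f) 0" for j js
    unfolding symmetric_coeffs_rotate[OF sym, symmetric] by (simp add: c_def)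
  have eq: "taylor_part f (Suc i) = (\<lambda>x. multi_sum (Suc i) c x * (1 / fact (Suc i)))"
    by (rule ext) (simp add: taylor_part_multi_sum c_def[abs_def])
  have fact: "of_nat (Suc i) * S * (1 / fact (Suc i)) = S / fact i" for S :: 'k
    by (simp only: fact_Suc of_nat_mult of_nat_fact) (simp add: field_simps del: of_nat_Suc)
  have "(taylor_part f (Suc i) has_derivative
      (\<lambda>v. of_nat (Suc i) * (\<Sum>j\<in>UNIV. v $ j * multi_sum i (\<lambda>js. c (j # js)) x) * (1 / fact (Suc i)))) (at x)"
    unfolding eq by (rule has_derivative_mult_left[OF multi_sum_has_derivative[OF sym]])
  then show ?thesis
    unfolding fact c by (simp add: taylor_part_multi_sum sum_divide_distrib)
qed

section \<open>The leading form of a gradient\<close>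

text \<open>Collects what the blow-up uses about a germ and its lowest part, free of the ground
  field. The index \<open>m\<close> is the degree of the leading gradient, hence one less than the
  multiplicity.\<close>

locale leading_form =
  fixes f H :: "'a::euclidean_space \<Rightarrow> 'b::real_normed_vector"
    and f' H' :: "'a \<Rightarrow> 'a \<Rightarrow> 'b" and m :: nat and r C :: real
  assumes r_pos: "0 < r" and C_pos: "0 < C"
    and f_deriv: "norm x < r \<Longrightarrow> (f has_derivative f' x) (at x)"
    and H_deriv: "(H has_derivative H' x) (at x)"
    and H_scaleR: "H (t *\<^sub>R x) = t ^ Suc m *\<^sub>R H x"
    and H'_scaleR: "H' (t *\<^sub>R x) v = t ^ m *\<^sub>R H' x v"
    and H'_cont: "continuous_on UNIV (\<lambda>x. H' x v)"
    and H'_bound: "norm (H' x v) \<le> C * norm x ^ m * norm v"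
    and approx: "norm x < r \<Longrightarrow> norm (f' x v - H' x v) \<le> C * norm x ^ Suc m * norm v"
    and H_nonzero: "H \<noteq> (\<lambda>x. 0)"

text \<open>Taylor's estimate is applied to the partial derivatives, since a remainder bound for
  \<open>f\<close> itself says nothing about its gradient. Their parts of degree below
  \<open>m\<close> vanish, being derivatives of vanishing parts of \<open>f\<close>.\<close>

lemma field_smooth_leading_form:
  fixes f :: "'k::{real_normed_field,euclidean_space}^'n \<Rightarrow> 'k"
  assumes "open U" "field_smooth_on U f" "0 \<in> U"
    and vanish: "\<And>i. i < Suc m \<Longrightarrow> taylor_part f i = (\<lambda>x. 0)"
    and nonzero: "taylor_part f (Suc m) \<noteq> (\<lambda>x. 0)"
  shows "\<exists>f' H' r C. leading_form f (taylor_part f (Suc m)) f' H' m r C"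
proof -
  define p where "p j = taylor_part (partial_deriv j f) m" for j
  have smooth: "field_smooth_on U (partial_deriv j f)" for j
    by (rule field_smooth_on_partial[OF assms(2)])
  have low: "taylor_part (partial_deriv j f) i = (\<lambda>x. 0)" if "i < m" for i j
  proof
    fix x
    have "(taylor_part f (Suc i) has_derivative (\<lambda>v. 0)) (at x)"
      using vanish[of "Suc i"] that by simp
    then have "(\<lambda>v. \<Sum>j\<in>UNIV. v $ j * taylor_part (partial_deriv j f) i x) = (\<lambda>v. 0)"
      using taylor_part_has_derivative[OF assms(1-3)] has_derivative_unique by blast
    then have "(\<Sum>k\<in>UNIV. axis j 1 $ k * taylor_part (partial_deriv k f) i x) = 0"
      by (rule fun_cong)
    moreover have "(\<Sum>k\<in>UNIV. axis j 1 $ k * taylor_part (partial_deriv k f) i x)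
        = (\<Sum>k\<in>UNIV. if k = j then taylor_part (partial_deriv k f) i x else 0)"
      by (rule sum.cong) (auto simp: axis_def)
    ultimately show "taylor_part (partial_deriv j f) i x = 0" by simp
  qed
  have "\<exists>r>0. \<exists>C. \<forall>y. norm y < r \<longrightarrow> norm (partial_deriv j f y - p j y) \<le> C * norm y ^ Suc m" for j
    using taylor_remainder_bound[OF assms(1) smooth assms(3), of "Suc m" j]
    by (simp add: low p_def)
  then obtain \<rho> K where \<rho>: "\<And>j. \<rho> j > 0"
    and K: "\<And>j y. norm y < \<rho> j \<Longrightarrow> norm (partial_deriv j f y - p j y) \<le> K j * norm y ^ Suc m"
    by metis
  have "\<exists>B. \<forall>x. norm (p j x) \<le> B * norm x ^ m" for j
  proof -
    let ?c = "\<lambda>js. foldr partial_deriv js (partial_deriv j f) 0"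
    have "norm (p j x) \<le> (\<Sum>js\<in>{js. length js = m}. norm (?c js)) / fact m * norm x ^ m" for x
      unfolding p_def taylor_part_multi_sum norm_divide
      using norm_multi_sum_le[of m ?c "\<lambda>js. norm (?c js)" x]
      by (simp add: divide_right_mono)
    then show ?thesis by blast
  qed
  then obtain B where B: "\<And>j x. norm (p j x) \<le> B j * norm x ^ m"
    by metis
  obtain r0 where r0: "r0 > 0" "ball 0 r0 \<subseteq> U"
    using assms(1,3) openE by blast
  define r where "r = Min (insert r0 (range \<rho>))"
  have r: "r > 0" "r \<le> r0" "\<And>j. r \<le> \<rho> j"
  proof -
    show "r > 0" using r0(1) \<rho> by (simp add: r_def)
    show "r \<le> r0" unfolding r_def by (rule Min_le) auto
    show "r \<le> \<rho> j" for j unfolding r_def by (rule Min_le) auto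
  qed
  \<comment> \<open>One constant serves both for the size of the leading gradient and for the
    remainder; the summand 1 makes it positive.\<close>
  define C where "C = 1 + (\<Sum>j\<in>UNIV. \<bar>K j\<bar>) + (\<Sum>j\<in>UNIV. \<bar>B j\<bar>)"
  have nn: "0 \<le> (\<Sum>j\<in>UNIV. \<bar>K j\<bar>)" "0 \<le> (\<Sum>j\<in>UNIV. \<bar>B j\<bar>)"
    by (simp_all add: sum_nonneg)
  have lin_bound: "norm (\<Sum>j\<in>UNIV. v $ j * q j) \<le> C * N * norm v"
    if q: "\<And>j. norm (q j) \<le> M j * N" and "0 \<le> N" and MC: "(\<Sum>j\<in>UNIV. \<bar>M j\<bar>) \<le> C"
    for v :: "'k^'n" and q M N
  proof -
    have "norm (\<Sum>j\<in>UNIV. v $ j * q j) \<le> (\<Sum>j\<in>UNIV. norm v * (\<bar>M j\<bar> * N))"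
    proof (rule sum_norm_le)
      fix j
      have "norm (q j) \<le> \<bar>M j\<bar> * N"
        using q[of j] mult_right_mono[OF abs_ge_self \<open>0 \<le> N\<close>, of "M j"] by linarith
      then show "norm (v $ j * q j) \<le> norm v * (\<bar>M j\<bar> * N)"
        unfolding norm_mult by (intro mult_mono norm_vec_nth_le) auto
    qed
    also have "\<dots> = (\<Sum>j\<in>UNIV. \<bar>M j\<bar>) * (N * norm v)"
      by (simp add: sum_distrib_left sum_distrib_right mult_ac)
    also have "\<dots> \<le> C * (N * norm v)"
      using MC \<open>0 \<le> N\<close> by (intro mult_right_mono) auto
    finally show ?thesis by (simp add: mult.assoc)
  qed
  have "leading_form f (taylor_part f (Suc m)) (field_deriv f) (\<lambda>x v. \<Sum>j\<in>UNIV. v $ j * p j x) m r C"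
  proof
    show "0 < r" by (rule r(1))
    show "0 < C" using nn unfolding C_def by linarith
    show "taylor_part f (Suc m) \<noteq> (\<lambda>x. 0)" by (rule nonzero)
    fix x v :: "'k^'n" and t :: real
    show "(taylor_part f (Suc m) has_derivative (\<lambda>v. \<Sum>j\<in>UNIV. v $ j * p j x)) (at x)"
      unfolding p_def by (rule taylor_part_has_derivative[OF assms(1-3)])
    show "taylor_part f (Suc m) (t *\<^sub>R x) = t ^ Suc m *\<^sub>R taylor_part f (Suc m) x"
      by (rule taylor_part_scaleR)
    show "(\<Sum>j\<in>UNIV. v $ j * p j (t *\<^sub>R x)) = t ^ m *\<^sub>R (\<Sum>j\<in>UNIV. v $ j * p j x)"
      by (simp add: p_def taylor_part_scaleR scaleR_sum_right)
    show "continuous_on UNIV (\<lambda>x. \<Sum>j\<in>UNIV. v $ j * p j x)"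
      unfolding p_def taylor_part_multi_sum by (intro continuous_intros) auto
    show "norm (\<Sum>j\<in>UNIV. v $ j * p j x) \<le> C * norm x ^ m * norm v"
      by (rule lin_bound[OF B]) (use nn in \<open>auto simp: C_def\<close>)
    assume x: "norm x < r"
    show "(f has_derivative field_deriv f x) (at x)"
      by (rule field_diff_at_has_derivative[OF field_smooth_on_diff[OF assms(2)]])
        (use x r r0 in auto)
    have "norm (\<Sum>j\<in>UNIV. v $ j * (partial_deriv j f x - p j x)) \<le> C * norm x ^ Suc m * norm v"
      by (rule lin_bound[OF K[OF less_le_trans[OF x r(3)]]]) (use nn in \<open>auto simp: C_def\<close>)
    then show "norm (field_deriv f x v - (\<Sum>j\<in>UNIV. v $ j * p j x)) \<le> C * norm x ^ Suc m * norm v"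
      by (simp only: sum_subtractf right_diff_distrib)
  qed
  then show ?thesis by blast
qed

lemma multiplicity_leading_form:
  fixes f :: "'k::{real_normed_field,euclidean_space}^'n \<Rightarrow> 'k"
  assumes "open U" "field_smooth_on U f" "0 \<in> U"
    and "finite_multiplicity f" "multiplicity_at_0 f = Suc m"
  shows "\<exists>f' H' r C. leading_form f (lowest_part f) f' H' m r C"
  unfolding lowest_part_def assms(5)
proof (rule field_smooth_leading_form[OF assms(1-3)])
  obtain k where "taylor_part f k \<noteq> (\<lambda>x. 0)"
    using assms(4) unfolding finite_multiplicity_def by blast
  then show "taylor_part f (Suc m) \<noteq> (\<lambda>x. 0)"
    using LeastI[of "\<lambda>k. taylor_part f k \<noteq> (\<lambda>x. 0)" k]
    unfolding assms(5)[unfolded multiplicity_at_0_def] by blast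
  show "taylor_part f i = (\<lambda>x. 0)" if "i < Suc m" for i
    using not_less_Least[of i "\<lambda>k. taylor_part f k \<noteq> (\<lambda>x. 0)"] that
    unfolding assms(5)[unfolded multiplicity_at_0_def] by blast
qed

section \<open>Nonvanishing and rescaling of the leading gradient\<close>

context leading_form
begin

text \<open>A derivative vanishing on a ball makes \<open>H\<close> constant there, equal to
  \<open>H 0 = 0\<close>, and homogeneity spreads this to the whole space.\<close>

lemma H'_nonzero_near_0:
  assumes "open U" "0 \<in> U"
  shows "\<exists>x\<in>U. H' x \<noteq> (\<lambda>v. 0)"
proof (rule ccontr)
  assume "\<not> ?thesis"
  then have 0: "\<And>x. x \<in> U \<Longrightarrow> H' x = (\<lambda>v. 0)" by blast
  obtain e where e: "e > 0" "cball 0 e \<subseteq> U"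
    using assms open_contains_cball by blast
  have "\<exists>c. \<forall>x\<in>cball 0 e. H x = c"
  proof (rule has_derivative_zero_constant)
    show "(H has_derivative (\<lambda>h. 0)) (at x within cball 0 e)" if "x \<in> cball 0 e" for x
    proof -
      have "x \<in> U" using that e(2) by blast
      from 0[OF this] H_deriv[of x] show ?thesis by (simp add: has_derivative_at_withinI)
    qed
  qed simp
  moreover have "H 0 = 0" using H_scaleR[of 0 0] by simp
  ultimately have ball: "H x = 0" if "norm x \<le> e" for x
    using that e(1) by (metis mem_cball_0 norm_zero less_imp_le)
  have "H x = 0" for x
  proof (cases "x = 0")
    case False
    have "H ((e / norm x) *\<^sub>R x) = 0" using ball e(1) False by simp
    then show ?thesis using H_scaleR[of "e / norm x" x] e(1) False by simp
  qed (use \<open>H 0 = 0\<close> in simp)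
  then show False using H_nonzero by blast
qed

lemma mem_singular_set_iff: "x \<in> singular_set H \<longleftrightarrow> H' x = (\<lambda>v. 0)"
  using H_deriv[of x] has_derivative_unique unfolding singular_set_def by auto

lemma f'_bound:
  assumes "norm x < r" "norm x \<le> 1"
  shows "norm (f' x v) \<le> 2 * C * norm x ^ m * norm v"
proof -
  have "norm (f' x v) \<le> norm (f' x v - H' x v) + norm (H' x v)"
    using norm_triangle_ineq[of "f' x v - H' x v" "H' x v"] by simp
  also have "\<dots> \<le> C * norm x ^ Suc m * norm v + C * norm x ^ m * norm v"
    by (intro add_mono approx H'_bound assms(1))
  also have "\<dots> \<le> C * norm x ^ m * norm v + C * norm x ^ m * norm v"
    using assms(2) C_pos power_decreasing[of m "Suc m" "norm x"]
    by (intro add_mono mult_right_mono mult_left_mono) auto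
  finally show ?thesis by (simp add: algebra_simps)
qed

text \<open>By homogeneity the leading term becomes \<open>H' (y n /\<^sub>R t n) v\<close>, which
  converges by continuity; the remainder carries an extra factor \<open>norm (y n)\<close>, which
  tends to 0. The points \<open>y n\<close> need not lie on a ray, so that images of points on a ray
  can be inserted.\<close>

lemma rescaled_derivative_tendsto:
  assumes "(t \<longlongrightarrow> 0) F" "\<forall>\<^sub>F n in F. 0 < t n" "((\<lambda>n. y n /\<^sub>R t n) \<longlongrightarrow> z) F"
  shows "((\<lambda>n. f' (y n) v /\<^sub>R t n ^ m) \<longlongrightarrow> H' z v) F"
proof -
  have "((\<lambda>n. t n *\<^sub>R (y n /\<^sub>R t n)) \<longlongrightarrow> 0 *\<^sub>R z) F"
    using assms by (intro tendsto_intros)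
  moreover have "\<forall>\<^sub>F n in F. t n *\<^sub>R (y n /\<^sub>R t n) = y n"
    using assms(2) by eventually_elim simp
  ultimately have y0: "(y \<longlongrightarrow> 0) F" by (simp add: tendsto_cong)
  have H: "((\<lambda>n. H' (y n /\<^sub>R t n) v) \<longlongrightarrow> H' z v) F"
    by (rule continuous_on_tendsto_compose[OF H'_cont assms(3)]) auto
  have ev: "\<forall>\<^sub>F n in F. norm (y n) < r"
    using order_tendstoD(2)[OF tendsto_norm[OF y0], of r] r_pos by simp
  have "((\<lambda>n. C * norm (y n /\<^sub>R t n) ^ m * norm (y n) * norm v) \<longlongrightarrow> C * norm z ^ m * norm (0::'a) * norm v) F"
    by (intro tendsto_intros assms(3) y0)
  then have lim0: "((\<lambda>n. C * norm (y n /\<^sub>R t n) ^ m * norm (y n) * norm v) \<longlongrightarrow> 0) F" by simp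
  have "((\<lambda>n. f' (y n) v /\<^sub>R t n ^ m - H' (y n /\<^sub>R t n) v) \<longlongrightarrow> 0) F"
  proof (rule Lim_null_comparison[OF _ lim0])
    show "\<forall>\<^sub>F n in F. norm (f' (y n) v /\<^sub>R t n ^ m - H' (y n /\<^sub>R t n) v)
        \<le> C * norm (y n /\<^sub>R t n) ^ m * norm (y n) * norm v"
      using ev assms(2)
    proof eventually_elim
      case (elim n)
      have "f' (y n) v /\<^sub>R t n ^ m - H' (y n /\<^sub>R t n) v = (f' (y n) v - H' (y n) v) /\<^sub>R t n ^ m"
        using H'_scaleR[of "inverse (t n)" "y n" v] by (simp add: scaleR_diff_right power_inverse)
      then have "norm (f' (y n) v /\<^sub>R t n ^ m - H' (y n /\<^sub>R t n) v) = norm (f' (y n) v - H' (y n) v) / t n ^ m"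
        using elim(2) by (simp add: divide_inverse_commute)
      also have "\<dots> \<le> C * norm (y n) ^ Suc m * norm v / t n ^ m"
        using approx[OF elim(1), of v] elim(2) by (intro divide_right_mono) auto
      also have "\<dots> = C * norm (y n /\<^sub>R t n) ^ m * norm (y n) * norm v"
        using elim(2) by (simp add: power_divide divide_inverse power_mult_distrib power_inverse)
      finally show ?case .
    qed
  qed
  from tendsto_add[OF this H] show ?thesis by simp
qed

end

section \<open>Real and holomorphic germs\<close>

text \<open>The witness \<open>D\<close> in \<open>C_k_on\<close> is pinned down only on
  \<open>U\<close>, while \<open>partial_deriv j f\<close> is a total function; on an open set the
  two can be exchanged.\<close>

lemma C_k_on_cong:
  assumes "open U" "\<And>x. x \<in> U \<Longrightarrow> f x = g x" "C_k_on k f U"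
  shows "C_k_on k g U"
proof (cases k)
  case 0
  then show ?thesis using assms continuous_on_cong[of U U f g] by simp
next
  case (Suc l)
  then obtain D where D: "\<And>x. x \<in> U \<Longrightarrow> (f has_derivative D x) (at x)" "\<And>v. C_k_on l (\<lambda>x. D x v) U"
    using assms(3) by auto
  have "(g has_derivative D x) (at x)" if "x \<in> U" for x
    by (rule has_derivative_transform_within_open[OF D(1)[OF that] assms(1) that assms(2)])
  with D(2) show ?thesis unfolding Suc by auto
qed

lemma vector_scalar_mult_real: "(c::real) *s v = c *\<^sub>R v"
  by (simp add: vec_eq_iff)

lemma C_k_on_partial_deriv:
  fixes f :: "real^'n \<Rightarrow> real"
  assumes "open U" "C_k_on (Suc k) f U"
  shows "C_k_on k (partial_deriv j f) U"
proof -
  obtain D where D: "\<And>x. x \<in> U \<Longrightarrow> (f has_derivative D x) (at x)" "\<And>v. C_k_on k (\<lambda>x. D x v) U"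
    using assms(2) by auto
  have "D x (axis j 1) = partial_deriv j f x" if "x \<in> U" for x
  proof -
    have "D x (c *s v) = c * D x v" for c v
      using linear_cmul[OF has_derivative_linear[OF D(1)[OF that]]]
      by (simp add: vector_scalar_mult_real)
    then show ?thesis using field_diff_at_partial[OF D(1)[OF that]] by simp
  qed
  then show ?thesis by (rule C_k_on_cong[OF assms(1) _ D(2)])
qed

lemma real_smooth_germ_field_smooth:
  fixes f :: "real^'n \<Rightarrow> real"
  assumes "real_smooth_germ f"
  shows "\<exists>U. open U \<and> 0 \<in> U \<and> field_smooth_on U f"
proof -
  obtain U where U: "open U" "0 \<in> U" "\<And>k. C_k_on k f U"
    using assms unfolding real_smooth_germ_def by blast
  have *: "C_k_on k (foldr partial_deriv js f) U" for k js
    by (induction js arbitrary: k) (auto intro: U C_k_on_partial_deriv[OF U(1)] simp del: C_k_on.simps)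
  have "field_diff_at (foldr partial_deriv js f) z" if "z \<in> U" for js z
  proof -
    obtain D' where "\<forall>z\<in>U. (foldr partial_deriv js f has_derivative D' z) (at z)"
      using *[of "Suc 0" js] unfolding C_k_on.simps(2) by (elim exE conjE)
    with that obtain D where D: "(foldr partial_deriv js f has_derivative D) (at z)"
      by (elim ballE) auto
    then show ?thesis
      using linear_cmul[OF has_derivative_linear[OF D]]
      unfolding field_diff_at_def vector_scalar_mult_real by auto
  qed
  then show ?thesis using U unfolding field_smooth_on_def by blast
qed

section \<open>Cauchy's formula and complex partial derivatives\<close>

lemma contour_integral_circlepath_0:
  assumes "r \<noteq> 0"
  shows "contour_integral (circlepath 0 r) (\<lambda>u. g u / u\<^sup>2)
    = 2 * pi * \<i> * integral {0..1} (\<lambda>t. g (of_real r * exp (2 * of_real pi * \<i> * of_real t)) / (of_real r * exp (2 * of_real pi * \<i> * of_real t)))"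
proof -
  let ?\<gamma> = "\<lambda>t::real. of_real r * exp (2 * of_real pi * \<i> * of_real t)"
  have "contour_integral (circlepath 0 r) (\<lambda>u. g u / u\<^sup>2)
      = integral {0..1} (\<lambda>t. 2 * pi * \<i> * (g (?\<gamma> t) / ?\<gamma> t))"
    unfolding contour_integral_integral
  proof (rule integral_cong)
    fix t :: real
    \<comment> \<open>The velocity of the circle is proportional to its position, which cancels one
      factor of the squared denominator.\<close>
    have "vector_derivative (circlepath 0 r) (at t) = 2 * pi * \<i> * ?\<gamma> t"
      by (simp add: vector_derivative_circlepath mult_ac)
    moreover have "circlepath 0 r t = ?\<gamma> t"
      by (simp add: circlepath)
    ultimately show "g (circlepath 0 r t) / (circlepath 0 r t)\<^sup>2 * vector_derivative (circlepath 0 r) (at t)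
        = 2 * pi * \<i> * (g (?\<gamma> t) / ?\<gamma> t)"
      using assms by (simp add: power2_eq_square)
  qed
  then show ?thesis by (simp only: integral_mult_right)
qed

lemma norm_axis_scalar: "norm (c *s axis j 1 :: complex^'n) = norm c"
proof -
  have "c *s axis j 1 = (axis j c :: complex^'n)" by (auto simp: vec_eq_iff axis_def)
  then show ?thesis by (simp add: norm_axis)
qed

text \<open>Cauchy's formula for the first derivative on the complex line through \<open>z\<close>
  in direction \<open>axis j 1\<close>. Over the fixed interval \<open>{0..1}\<close> it depends on
  \<open>z\<close> only through the integrand, so it is an integral with a parameter.\<close>

lemma partial_deriv_circle_integral:
  fixes f :: "complex^'n \<Rightarrow> complex"
  assumes "\<And>w. w \<in> U \<Longrightarrow> field_diff_at f w" "cball z r \<subseteq> U" "r > 0"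
  shows "partial_deriv j f z = integral {0..1} (\<lambda>t. f (z + (of_real r * exp (2 * of_real pi * \<i> * of_real t)) *s axis j 1)
       / (of_real r * exp (2 * of_real pi * \<i> * of_real t)))"
proof -
  let ?g = "\<lambda>u. f (z + u *s axis j 1)"
  have der: "(?g has_field_derivative partial_deriv j f (z + a *s axis j 1)) (at a)" if "a \<in> cball 0 r" for a
    by (rule field_diff_at_line_partial, rule assms(1), rule subsetD[OF assms(2)])
      (use that in \<open>simp add: dist_norm norm_axis_scalar\<close>)
  have cont: "continuous_on (cball 0 r) ?g"
    using der DERIV_continuous by (blast intro: continuous_at_imp_continuous_on)
  have hol: "?g holomorphic_on ball 0 r"
    unfolding holomorphic_on_open[OF open_ball]
    using der by (meson ball_subset_cball subsetD)
  have "(?g has_field_derivative (1 / (2 * of_real pi * \<i>) * contour_integral (circlepath 0 r) (\<lambda>u. ?g u / (u - 0)\<^sup>2))) (at 0)"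
    by (rule Cauchy_derivative_integral_circlepath(2)[OF cont hol]) (use assms(3) in simp)
  then have "partial_deriv j f z = 1 / (2 * of_real pi * \<i>) * contour_integral (circlepath 0 r) (\<lambda>u. ?g u / u\<^sup>2)"
    unfolding partial_deriv_def by (simp add: DERIV_imp_deriv)
  then show ?thesis
    using contour_integral_circlepath_0[of r ?g] assms(3) by simp
qed

lemma bounded_linear_field_deriv: "bounded_linear (field_deriv f (z::'k::{real_normed_field,euclidean_space}^'n))"
proof -
  have "linear (field_deriv f z)"
    by (rule linearI) (auto simp: sum.distrib algebra_simps scaleR_sum_right)
  then show ?thesis using linear_conv_bounded_linear by blast
qed

text \<open>Cauchy's formula expresses the partial derivative by values of \<open>f\<close> alone,
  so it can be differentiated under the integral sign; complex linearity passes from the integrand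
  to the integral.\<close>

lemma field_diff_at_partial_deriv_complex:
  fixes f :: "complex^'n \<Rightarrow> complex"
  assumes U: "open U" and f: "\<And>w. w \<in> U \<Longrightarrow> field_diff_at f w" and z0: "z0 \<in> U"
  shows "field_diff_at (partial_deriv j f) z0"
proof -
  obtain r' where r': "r' > 0" "cball z0 r' \<subseteq> U"
    using U z0 open_contains_cball by blast
  \<comment> \<open>Half the radius, so that circles of radius \<open>r\<close> about all points of
    \<open>ball z0 r\<close> stay in \<open>U\<close>.\<close>
  define r where "r = r' / 2"
  have r: "r > 0" using r' by (simp add: r_def)
  define \<gamma> where "\<gamma> t = of_real r * exp (2 * of_real pi * \<i> * of_real t)" for t :: real
  have \<gamma>0: "\<gamma> t \<noteq> 0" for t using r by (simp add: \<gamma>_def)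
  have n\<gamma>: "norm (\<gamma> t) = r" for t using r by (simp add: \<gamma>_def norm_mult)
  have cont\<gamma>: "continuous_on S \<gamma>" for S unfolding \<gamma>_def by (intro continuous_intros)
  have contf: "continuous_on U f"
    using f field_diff_at_has_derivative has_derivative_continuous
    by (blast intro: continuous_at_imp_continuous_on)
  \<comment> \<open>Differentiating under the integral requires continuous first partial
    derivatives. They come from the same formula, as integrals with a parameter of a continuous
    integrand.\<close>
  have cont_pd: "continuous_on U (partial_deriv k f)" for k
  proof (rule continuous_at_imp_continuous_on, rule ballI)
    fix z assume "z \<in> U"
    then obtain s' where s': "s' > 0" "cball z s' \<subseteq> U"
      using U open_contains_cball by blast
    define s where "s = s' / 2"
    have s: "s > 0" using s' by (simp add: s_def)
    let ?\<delta> = "\<lambda>t::real. of_real s * exp (2 * of_real pi * \<i> * of_real t)"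
    have inU: "w + ?\<delta> t *s axis k 1 \<in> U" if "w \<in> ball z s" for w t
    proof -
      have "dist z (w + ?\<delta> t *s axis k 1) \<le> dist z w + dist w (w + ?\<delta> t *s axis k 1)"
        by (rule dist_triangle)
      also have "dist w (w + ?\<delta> t *s axis k 1) = s"
        using s by (simp add: dist_norm norm_axis_scalar norm_mult)
      finally show ?thesis using that s'(2) by (auto simp: s_def)
    qed
    have "continuous_on (ball z s \<times> cbox 0 1) (\<lambda>(w, t). f (w + ?\<delta> t *s axis k 1) / ?\<delta> t)"
      unfolding case_prod_unfold
      by (intro continuous_intros continuous_on_compose2[OF contf] 
            bounded_linear.continuous_on[OF bounded_linear_vector_scalar_mult_left])
        (use inU s in auto)
    then have "continuous_on (ball z s) (\<lambda>w. integral (cbox 0 1) (\<lambda>t. f (w + ?\<delta> t *s axis k 1) / ?\<delta> t))"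
      by (rule integral_continuous_on_param)
    moreover have "partial_deriv k f w = integral (cbox 0 1) (\<lambda>t. f (w + ?\<delta> t *s axis k 1) / ?\<delta> t)" if "w \<in> ball z s" for w
    proof -
      have "cball w s \<subseteq> U"
      proof
        fix x assume "x \<in> cball w s"
        then have "dist z x \<le> s'" using dist_triangle[of z x w] that by (auto simp: s_def)
        then show "x \<in> U" using s'(2) by auto
      qed
      from partial_deriv_circle_integral[OF f this s] show ?thesis by simp
    qed
    ultimately have "continuous_on (ball z s) (partial_deriv k f)"
      using continuous_on_cong by (metis (no_types, lifting))
    then show "isCont (partial_deriv k f) z"
      using s by (simp add: continuous_on_eq_continuous_at)
  qed
  have inU: "w + \<gamma> t *s axis j 1 \<in> U" if "w \<in> ball z0 r" for w t
  proof -
    have "dist z0 (w + \<gamma> t *s axis j 1) \<le> dist z0 w + dist w (w + \<gamma> t *s axis j 1)"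
      by (rule dist_triangle)
    also have "dist w (w + \<gamma> t *s axis j 1) = r"
      by (simp add: dist_norm norm_axis_scalar n\<gamma>)
    finally show ?thesis using that r'(2) by (auto simp: r_def)
  qed
  \<comment> \<open>The Leibniz rule takes the derivative as a continuous function into bounded
    linear maps; in finite dimension its continuity can be checked vector by vector.\<close>
  define D where "D w t = Blinfun (\<lambda>v. field_deriv f (w + \<gamma> t *s axis j 1) v / \<gamma> t)" for w t
  have D: "blinfun_apply (D w t) = (\<lambda>v. field_deriv f (w + \<gamma> t *s axis j 1) v / \<gamma> t)" for w t
    unfolding D_def
    by (rule bounded_linear_Blinfun_apply, rule bounded_linear_compose[OF bounded_linear_divide bounded_linear_field_deriv])
  have line: "continuous_on (ball z0 r \<times> cbox 0 1) (\<lambda>x. fst x + \<gamma> (snd x) *s axis j 1)"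
    by (intro continuous_intros continuous_on_compose2[OF cont\<gamma>] 
          bounded_linear.continuous_on[OF bounded_linear_vector_scalar_mult_left]) auto
  have contD: "continuous_on (ball z0 r \<times> cbox 0 1) (\<lambda>(w, t). D w t)"
    unfolding case_prod_unfold
    by (rule continuous_on_blinfun_componentwise, unfold D)
      (intro continuous_intros continuous_on_compose2[OF cont_pd line] continuous_on_compose2[OF cont\<gamma>];
        use inU \<gamma>0 in auto)
  have intgr: "(\<lambda>t. f (w + \<gamma> t *s axis j 1) / \<gamma> t) integrable_on cbox 0 1" if "w \<in> ball z0 r" for w
    by (rule integrable_continuous)
      (intro continuous_intros continuous_on_compose2[OF contf] cont\<gamma>
          bounded_linear.continuous_on[OF bounded_linear_vector_scalar_mult_left];
        use inU that \<gamma>0 in auto)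
  have leibniz: "((\<lambda>w. integral (cbox 0 1) (\<lambda>t. f (w + \<gamma> t *s axis j 1) / \<gamma> t)) has_derivative
      blinfun_apply (integral (cbox 0 1) (D z0))) (at z0 within ball z0 r)"
  proof (rule leibniz_rule[OF _ intgr contD])
    fix w t assume w: "w \<in> ball z0 r"
    have "((\<lambda>w. f (w + \<gamma> t *s axis j 1)) has_derivative field_deriv f (w + \<gamma> t *s axis j 1)) (at w)"
      by (rule has_derivative_compose[of "\<lambda>w. w + \<gamma> t *s axis j 1", OF _ field_diff_at_has_derivative[OF f[OF inU[OF w]]]])
        (auto intro!: derivative_eq_intros)
    then have "((\<lambda>w. f (w + \<gamma> t *s axis j 1) / \<gamma> t) has_derivative blinfun_apply (D w t)) (at w)"
      unfolding D by (rule bounded_linear.has_derivative[OF bounded_linear_divide])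
    then show "((\<lambda>w. f (w + \<gamma> t *s axis j 1) / \<gamma> t) has_derivative blinfun_apply (D w t)) (at w within ball z0 r)"
      by (rule has_derivative_at_withinI)
  qed (use r in auto)
  have "partial_deriv j f w = integral (cbox 0 1) (\<lambda>t. f (w + \<gamma> t *s axis j 1) / \<gamma> t)" if "w \<in> ball z0 r" for w
  proof -
    have "cball w r \<subseteq> U"
    proof
      fix x assume "x \<in> cball w r"
      then have "dist z0 x \<le> r'" using dist_triangle[of z0 x w] that by (auto simp: r_def)
      then show "x \<in> U" using r'(2) by auto
    qed
    from partial_deriv_circle_integral[OF f this r] show ?thesis by (simp add: \<gamma>_def)
  qed
  then have "(partial_deriv j f has_derivative blinfun_apply (integral (cbox 0 1) (D z0))) (at z0 within ball z0 r)"
    using has_derivative_transform[OF _ _ leibniz, of "partial_deriv j f"] r by simp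
  then have der: "(partial_deriv j f has_derivative blinfun_apply (integral (cbox 0 1) (D z0))) (at z0)"
    using r by (simp add: at_within_open[of z0 "ball z0 r"])
  have contD0: "continuous_on (cbox 0 1) (D z0)"
    by (rule continuous_on_compose2[OF contD, of _ "\<lambda>t. (z0, t)", simplified])
      (use r in \<open>auto intro!: continuous_intros\<close>)
  have "blinfun_apply (integral (cbox 0 1) (D z0)) (c *s v) = c * blinfun_apply (integral (cbox 0 1) (D z0)) v" for c v
  proof -
    have "blinfun_apply (D z0 t) (c *s v) = c * blinfun_apply (D z0 t) v" for t
      unfolding D by (simp add: sum_distrib_left mult_ac)
    then show ?thesis
      unfolding blinfun_apply_integral[OF integrable_continuous[OF contD0]] by simp
  qed
  then show ?thesis using der unfolding field_diff_at_def by blast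
qed

lemma holomorphic_germ_field_smooth:
  fixes f :: "complex^'n \<Rightarrow> complex"
  assumes "holomorphic_germ f"
  shows "\<exists>U. open U \<and> 0 \<in> U \<and> field_smooth_on U f"
proof -
  obtain U where U: "open U" "0 \<in> U" "\<And>z. z \<in> U \<Longrightarrow> field_diff_at f z"
    using assms unfolding holomorphic_germ_def field_diff_at_def by blast
  have "\<forall>z\<in>U. field_diff_at (foldr partial_deriv js f) z" for js
  proof (induction js)
    case (Cons j js)
    then show ?case using field_diff_at_partial_deriv_complex[OF U(1)] by simp
  qed (use U in auto)
  then show ?thesis using U unfolding field_smooth_on_def by blast
qed

section \<open>Bi-Lipschitz maps and gradients\<close>

text \<open>A Lipschitz bound for the inverse replaces the lower bound in
  \<open>bilip_homeo\<close>. The two maps then play symmetric roles, and each estimate can be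
  reused in the other direction.\<close>

definition bilip_pair ::
  "'a::real_normed_vector set \<Rightarrow> 'a set \<Rightarrow> ('a \<Rightarrow> 'a) \<Rightarrow> ('a \<Rightarrow> 'a) \<Rightarrow> real \<Rightarrow> bool" where
  "bilip_pair U V \<phi> \<psi> L \<longleftrightarrow> open U \<and> open V \<and> 0 \<in> U \<and> \<phi> 0 = 0 \<and> 0 < L \<and>
     (\<forall>z\<in>U. \<phi> z \<in> V \<and> \<psi> (\<phi> z) = z) \<and> (\<forall>w\<in>V. \<psi> w \<in> U \<and> \<phi> (\<psi> w) = w) \<and>
     (\<forall>x\<in>U. \<forall>y\<in>U. norm (\<phi> x - \<phi> y) \<le> L * norm (x - y)) \<and>
     (\<forall>x\<in>V. \<forall>y\<in>V. norm (\<psi> x - \<psi> y) \<le> L * norm (x - y))"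

lemma bilip_pair_sym:
  assumes "bilip_pair U V \<phi> \<psi> L"
  shows "bilip_pair V U \<psi> \<phi> L"
proof -
  have *: "0 \<in> U" "\<phi> 0 = 0" "\<forall>z\<in>U. \<phi> z \<in> V \<and> \<psi> (\<phi> z) = z"
    using assms unfolding bilip_pair_def by blast+
  then have "0 \<in> V" "\<psi> 0 = 0" by force+
  then show ?thesis using assms unfolding bilip_pair_def by blast
qed

lemma bilip_homeo_imp_pair:
  assumes "bilip_homeo U V \<phi>"
  obtains \<psi> L where "bilip_pair U V \<phi> \<psi> L"
proof -
  obtain \<psi> L where *: "open U" "open V" "0 \<in> U" "\<phi> 0 = 0" "homeomorphism U V \<phi> \<psi>" "L > 0"
    and lip: "\<And>x y. x \<in> U \<Longrightarrow> y \<in> U \<Longrightarrow> 1 / L * norm (x - y) \<le> norm (\<phi> x - \<phi> y)"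
      "\<And>x y. x \<in> U \<Longrightarrow> y \<in> U \<Longrightarrow> norm (\<phi> x - \<phi> y) \<le> L * norm (x - y)"
    using assms unfolding bilip_homeo_def by blast
  have \<phi>: "\<phi> z \<in> V" "\<psi> (\<phi> z) = z" if "z \<in> U" for z
    using *(5) that unfolding homeomorphism_def by blast+
  have \<psi>: "\<psi> z \<in> U" "\<phi> (\<psi> z) = z" if "z \<in> V" for z
    using *(5) that unfolding homeomorphism_def by blast+
  have "norm (\<psi> x - \<psi> y) \<le> L * norm (x - y)" if "x \<in> V" "y \<in> V" for x y
    using lip(1)[OF \<psi>(1)[OF that(1)] \<psi>(1)[OF that(2)]] \<psi>(2) that *(6)
    by (simp add: field_simps)
  then have "bilip_pair U V \<phi> \<psi> L"
    unfolding bilip_pair_def using * \<phi> \<psi> lip(2) by blast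
  then show ?thesis by (rule that)
qed

lemma lipschitz_bound_continuous_on:
  assumes "\<And>x y. x \<in> S \<Longrightarrow> y \<in> S \<Longrightarrow> norm (f x - f y) \<le> L * norm (x - y)" "0 \<le> L"
  shows "continuous_on S f"
proof -
  have "L-lipschitz_on S f"
    by (rule lipschitz_onI) (use assms in \<open>auto simp: dist_norm\<close>)
  then show ?thesis by (rule lipschitz_on_continuous_on)
qed

lemma bilip_pair_imp_homeo:
  assumes "bilip_pair U V \<phi> \<psi> L"
  shows "bilip_homeo U V \<phi>"
proof -
  have L: "L > 0" and \<phi>: "\<And>z. z \<in> U \<Longrightarrow> \<phi> z \<in> V" "\<And>z. z \<in> U \<Longrightarrow> \<psi> (\<phi> z) = z"
    and \<psi>: "\<And>z. z \<in> V \<Longrightarrow> \<psi> z \<in> U" "\<And>z. z \<in> V \<Longrightarrow> \<phi> (\<psi> z) = z"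
    and lip: "\<And>x y. x \<in> U \<Longrightarrow> y \<in> U \<Longrightarrow> norm (\<phi> x - \<phi> y) \<le> L * norm (x - y)"
      "\<And>x y. x \<in> V \<Longrightarrow> y \<in> V \<Longrightarrow> norm (\<psi> x - \<psi> y) \<le> L * norm (x - y)"
    using assms unfolding bilip_pair_def by blast+
  have "\<phi> ` U = V" "\<psi> ` V = U"
    using \<phi> \<psi> by (force simp: image_iff)+
  then have "homeomorphism U V \<phi> \<psi>"
    unfolding homeomorphism_def
    using \<phi>(2) \<psi>(2) lipschitz_bound_continuous_on[OF lip(1)] lipschitz_bound_continuous_on[OF lip(2)] L
    by auto
  moreover have "1 / L * norm (x - y) \<le> norm (\<phi> x - \<phi> y)" if "x \<in> U" "y \<in> U" for x y
    using lip(2)[OF \<phi>(1)[OF that(1)] \<phi>(1)[OF that(2)]] \<phi>(2) that L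
    by (simp add: field_simps)
  ultimately show ?thesis
    using assms lip(1) L unfolding bilip_homeo_def bilip_pair_def by blast
qed

text \<open>The substitute for the chain rule. An increment of \<open>F\<close> is an increment of
  \<open>G\<close> between images under \<open>\<psi>\<close>, hence at most
  \<open>N + \<epsilon>\<close> times their distance, which is at most
  \<open>L * norm (w - z)\<close>. Taking \<open>w\<close> on the line through \<open>z\<close> in
  direction \<open>v\<close> bounds \<open>D v\<close>.\<close>

lemma derivative_bound_transfer:
  assumes F: "(F has_derivative D) (at z)" and G: "(G has_derivative D') (at (\<psi> z))"
    and V: "open V" "z \<in> V" and eq: "\<And>w. w \<in> V \<Longrightarrow> F w = G (\<psi> w)"
    and lip: "\<And>w. w \<in> V \<Longrightarrow> norm (\<psi> w - \<psi> z) \<le> L * norm (w - z)"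
    and bound: "\<And>v. norm (D' v) \<le> N * norm v" and nonneg: "0 \<le> L" "0 \<le> N"
  shows "norm (D v) \<le> L * N * norm v"
proof (rule field_le_epsilon)
  fix e :: real assume "e > 0"
  interpret D: bounded_linear D using F by (rule has_derivative_bounded_linear)
  have pos: "(L + 1) * (norm v + 1) > 0"
    using nonneg by (intro mult_pos_pos) (auto simp: add_nonneg_pos)
  \<comment> \<open>Scaled so that the total error \<open>\<epsilon> * (L + 1) * norm v\<close> is
    at most \<open>e\<close>; the added ones keep the denominator positive if \<open>L\<close> or
    \<open>v\<close> is 0.\<close>
  define \<epsilon> where "\<epsilon> = e / ((L + 1) * (norm v + 1))"
  have \<epsilon>: "\<epsilon> > 0" using \<open>e > 0\<close> pos by (simp add: \<epsilon>_def)
  obtain d1 where d1: "d1 > 0" "\<And>w. norm (w - z) < d1 \<Longrightarrow> norm (F w - F z - D (w - z)) \<le> \<epsilon> * norm (w - z)"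
    using F \<epsilon> unfolding has_derivative_at_alt by blast
  obtain d2 where d2: "d2 > 0" "\<And>w. norm (w - \<psi> z) < d2 \<Longrightarrow> norm (G w - G (\<psi> z) - D' (w - \<psi> z)) \<le> \<epsilon> * norm (w - \<psi> z)"
    using G \<epsilon> unfolding has_derivative_at_alt by blast
  obtain d3 where d3: "d3 > 0" "ball z d3 \<subseteq> V"
    using V openE by blast
  define d where "d = min (min d1 d3) (d2 / (L + 1))"
  have d: "d > 0" using d1(1) d2(1) d3(1) nonneg by (simp add: d_def)
  define s where "s = d / (2 * (norm v + 1))"
  have np: "norm v + 1 > 0" by (simp add: add_nonneg_pos)
  have s: "s > 0" using d np by (simp add: s_def)
  define w where "w = z + s *\<^sub>R v"
  have wz: "w - z = s *\<^sub>R v" by (simp add: w_def)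
  have "s * norm v < d"
  proof -
    have "s * norm v < s * (norm v + 1)" using s by simp
    also have "\<dots> = d / 2" using np by (simp add: s_def field_simps)
    finally show ?thesis using d by simp
  qed
  then have nw: "norm (w - z) < d" using s by (simp add: wz)
  have wV: "w \<in> V" using nw d3(2) by (auto simp: d_def dist_norm norm_minus_commute)
  have "norm (\<psi> w - \<psi> z) \<le> L * norm (w - z)" by (rule lip[OF wV])
  also have "\<dots> \<le> (L + 1) * norm (w - z)" by (intro mult_right_mono) auto
  also have "\<dots> < d2" using nw nonneg by (simp add: d_def field_simps)
  finally have n\<psi>: "norm (\<psi> w - \<psi> z) < d2" .
  have "norm (F w - F z) = norm (G (\<psi> w) - G (\<psi> z))" using eq wV V(2) by simp
  also have "\<dots> \<le> norm (D' (\<psi> w - \<psi> z)) + norm (G (\<psi> w) - G (\<psi> z) - D' (\<psi> w - \<psi> z))"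
    using norm_triangle_ineq[of "D' (\<psi> w - \<psi> z)" "G (\<psi> w) - G (\<psi> z) - D' (\<psi> w - \<psi> z)"] by simp
  also have "\<dots> \<le> N * norm (\<psi> w - \<psi> z) + \<epsilon> * norm (\<psi> w - \<psi> z)"
    by (intro add_mono bound d2(2) n\<psi>)
  also have "\<dots> = (N + \<epsilon>) * norm (\<psi> w - \<psi> z)" by (simp add: algebra_simps)
  also have "\<dots> \<le> (N + \<epsilon>) * (L * norm (w - z))"
    using lip[OF wV] nonneg \<epsilon> by (intro mult_left_mono) auto
  finally have 1: "norm (F w - F z) \<le> (N + \<epsilon>) * (L * norm (w - z))" .
  have "norm (D (w - z)) \<le> norm (F w - F z) + norm (F w - F z - D (w - z))"
    using norm_triangle_ineq4[of "F w - F z" "F w - F z - D (w - z)"] by simp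
  also have "\<dots> \<le> (N + \<epsilon>) * (L * norm (w - z)) + \<epsilon> * norm (w - z)"
    using 1 d1(2)[of w] nw by (intro add_mono) (auto simp: d_def)
  finally have "s * norm (D v) \<le> s * (L * N * norm v + \<epsilon> * (L + 1) * norm v)"
    using s by (simp add: wz D.scaleR algebra_simps)
  then have "norm (D v) \<le> L * N * norm v + \<epsilon> * (L + 1) * norm v"
    using s by simp
  also have "\<epsilon> * (L + 1) * norm v \<le> \<epsilon> * ((L + 1) * (norm v + 1))"
    using \<epsilon> nonneg by (simp add: algebra_simps)
  also have "\<dots> = e"
  proof -
    have "e / X * X = e" if "0 < X" for X :: real using that by simp
    from this[OF pos] show ?thesis by (simp only: \<epsilon>_def)
  qed
  finally show "norm (D v) \<le> L * N * norm v + e" by simp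
qed

section \<open>Gradients in the presence of the quadratic forms\<close>

lemma signed_sum_of_squares_has_derivative:
  fixes Q :: "'k::{real_normed_field,euclidean_space}^'p \<Rightarrow> 'k"
  assumes "Q = (\<lambda>y. \<Sum>i\<in>UNIV. s i * (y $ i)\<^sup>2)"
  shows "(Q has_derivative (\<lambda>v. \<Sum>i\<in>UNIV. 2 * s i * y $ i * v $ i)) (at y)"
proof -
  have "((\<lambda>y :: 'k^'p. s i * (y $ i)\<^sup>2) has_derivative (\<lambda>v. 2 * s i * y $ i * v $ i)) (at y)" for i
    by (auto intro!: derivative_eq_intros bounded_linear.has_derivative[OF bounded_linear_vec_nth] simp: mult_ac)
  then show ?thesis unfolding assms by (rule has_derivative_sum)
qed

text \<open>The gradient of \<open>Qg\<close> vanishes at 0, so only \<open>g'\<close> contributes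
  at \<open>(x, 0)\<close>, while that of \<open>Qf\<close> at \<open>c\<close> has the entries
  \<open>2 * s i * c $ i\<close>. Vectors \<open>(u, 0)\<close> isolate \<open>f'\<close> and
  vectors \<open>(0, axis i 1)\<close> isolate the coordinates of \<open>c\<close>;
  \<open>CARD('p)\<close> arises from bounding the Euclidean norm by the sum of the
  coordinates.\<close>

lemma sum_of_squares_gradient_transfer:
  fixes f g :: "'k::{real_normed_field,euclidean_space}^'n \<Rightarrow> 'k" and Qf Qg :: "'k^'p \<Rightarrow> 'k"
    and \<psi> :: "('k^'n) \<times> ('k^'p) \<Rightarrow> ('k^'n) \<times> ('k^'p)" and L N :: real
  assumes Q: "signed_sum_of_squares Qf" "signed_sum_of_squares Qg"
    and f: "(f has_derivative f') (at a)" and g: "(g has_derivative g') (at x)"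
    and V: "open V" "(a, c) \<in> V" and eq: "\<And>w. w \<in> V \<Longrightarrow> f (fst w) + Qf (snd w) = g (fst (\<psi> w)) + Qg (snd (\<psi> w))"
    and \<psi>: "\<psi> (a, c) = (x, 0)"
    and lip: "\<And>w. w \<in> V \<Longrightarrow> norm (\<psi> w - \<psi> (a, c)) \<le> L * norm (w - (a, c))"
    and bound: "\<And>v. norm (g' v) \<le> N * norm v" and nonneg: "0 \<le> L" "0 \<le> N"
  shows "norm (f' u) \<le> L * N * norm u" "norm c \<le> CARD('p) * (L * N)"
proof -
  obtain s where s: "\<And>i. s i = 1 \<or> s i = - 1" and Qf: "Qf = (\<lambda>y. \<Sum>i\<in>UNIV. s i * (y $ i)\<^sup>2)"
    using Q(1) unfolding signed_sum_of_squares_def by blast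
  obtain s' where Qg: "Qg = (\<lambda>y. \<Sum>i\<in>UNIV. s' i * (y $ i)\<^sup>2)"
    using Q(2) unfolding signed_sum_of_squares_def by blast
  let ?D = "\<lambda>w. f' (fst w) + (\<Sum>i\<in>UNIV. 2 * s i * c $ i * snd w $ i)"
  have DF: "((\<lambda>w. f (fst w) + Qf (snd w)) has_derivative ?D) (at (a, c))"
    using f signed_sum_of_squares_has_derivative[OF Qf, of c]
    by (intro has_derivative_add has_derivative_compose[OF has_derivative_fst[OF has_derivative_ident]]
         has_derivative_compose[OF has_derivative_snd[OF has_derivative_ident]]) auto
  have "(Qg has_derivative (\<lambda>v. 0)) (at 0)"
    using signed_sum_of_squares_has_derivative[OF Qg, of 0] by simp
  then have "((\<lambda>w. g (fst w) + Qg (snd w)) has_derivative (\<lambda>w. g' (fst w) + 0)) (at (x, 0))"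
    using g by (intro has_derivative_add has_derivative_compose[OF has_derivative_fst[OF has_derivative_ident]]
         has_derivative_compose[OF has_derivative_snd[OF has_derivative_ident], where g' = "\<lambda>v. 0"]) auto
  then have DG: "((\<lambda>w. g (fst w) + Qg (snd w)) has_derivative (\<lambda>w. g' (fst w))) (at (\<psi> (a, c)))"
    by (simp add: \<psi>)
  have DGb: "norm (g' (fst w)) \<le> N * norm w" for w :: "('k^'n) \<times> ('k^'p)"
  proof -
    have "norm (fst w) \<le> norm w" using norm_fst_le[of "fst w" "snd w"] by simp
    from order_trans[OF bound mult_left_mono[OF this nonneg(2)]] show ?thesis .
  qed
  have main: "norm (?D w) \<le> L * N * norm w" for w
    by (rule derivative_bound_transfer[where \<psi> = \<psi> and z = "(a, c)", OF DF DG V _ _ DGb nonneg])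
      (rule eq lip; assumption)+
  show "norm (f' u) \<le> L * N * norm u"
    using main[of "(u, 0)"] by (simp add: norm_Pair)
  have f0: "f' 0 = 0" using f has_derivative_linear linear_0 by blast
  have "norm (c $ i) \<le> L * N" for i
  proof -
    have "(\<Sum>k\<in>UNIV. 2 * s k * c $ k * (axis i 1 :: 'k^'p) $ k) = (\<Sum>k\<in>UNIV. if k = i then 2 * s k * c $ k else 0)"
      by (rule sum.cong) (auto simp: axis_def)
    then have "norm (2 * s i * c $ i) \<le> L * N"
      using main[of "(0, axis i 1)"] by (simp add: f0 norm_Pair norm_axis)
    moreover have "norm (2 * s i * c $ i) = 2 * norm (c $ i)"
      using s[of i] by (auto simp: norm_mult)
    ultimately show ?thesis using norm_ge_zero[of "c $ i"] by linarith
  qed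
  then have "(\<Sum>i\<in>UNIV. norm (c $ i)) \<le> (\<Sum>i\<in>(UNIV :: 'p set). L * N)"
    by (intro sum_mono)
  moreover have "norm c \<le> (\<Sum>i\<in>UNIV. norm (c $ i))"
    unfolding norm_vec_def by (rule L2_set_le_sum) simp
  ultimately show "norm c \<le> CARD('p) * (L * N)" by simp
qed

text \<open>The transfer is applied to \<open>\<psi>\<close> at the point
  \<open>\<phi> (x, 0)\<close>. The bound \<open>N\<close> stays arbitrary: the generic order
  \<open>n\<close> of \<open>g'\<close> suffices for the second component, but at singular points of
  the lowest part a sharper bound will be inserted.\<close>

lemma sum_of_squares_section:
  fixes f g :: "'k::{real_normed_field,euclidean_space}^'n \<Rightarrow> 'k" and Qf Qg :: "'k^'p \<Rightarrow> 'k"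
    and \<phi> :: "('k^'n) \<times> ('k^'p) \<Rightarrow> ('k^'n) \<times> ('k^'p)"
  assumes Q: "signed_sum_of_squares Qf" "signed_sum_of_squares Qg"
    and f: "leading_form f Hf f' Hf' m rf Cf" and g: "leading_form g Hg g' Hg' n rg Cg" and n: "2 \<le> n"
    and pair: "bilip_pair U V \<phi> \<psi> L"
    and eq: "\<And>z. z \<in> U \<Longrightarrow> f (fst (\<phi> z)) + Qf (snd (\<phi> z)) = g (fst z) + Qg (snd z)"
  shows "\<exists>R>0. \<exists>K. \<forall>x. norm x \<le> R \<longrightarrow> (x, 0) \<in> U \<and> norm (snd (\<phi> (x, 0))) \<le> K * (norm x)\<^sup>2 \<and>
    (\<forall>N. 0 \<le> N \<longrightarrow> (\<forall>v. norm (g' x v) \<le> N * norm v) \<longrightarrow>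
      (\<forall>v. norm (f' (fst (\<phi> (x, 0))) v) \<le> L * N * norm v))"
proof -
  interpret f: leading_form f Hf f' Hf' m rf Cf by (rule f)
  interpret g: leading_form g Hg g' Hg' n rg Cg by (rule g)
  have U: "open U" "open V" "0 \<in> U" "\<phi> 0 = 0" and L: "0 < L"
    and \<phi>: "\<And>z. z \<in> U \<Longrightarrow> \<phi> z \<in> V \<and> \<psi> (\<phi> z) = z"
    and \<psi>: "\<And>w. w \<in> V \<Longrightarrow> \<psi> w \<in> U \<and> \<phi> (\<psi> w) = w"
    and lip\<phi>: "\<And>x y. x \<in> U \<Longrightarrow> y \<in> U \<Longrightarrow> norm (\<phi> x - \<phi> y) \<le> L * norm (x - y)"
    and lip\<psi>: "\<And>x y. x \<in> V \<Longrightarrow> y \<in> V \<Longrightarrow> norm (\<psi> x - \<psi> y) \<le> L * norm (x - y)"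
    using pair unfolding bilip_pair_def by blast+
  obtain \<rho> where \<rho>: "\<rho> > 0" "ball 0 \<rho> \<subseteq> U"
    using U openE by blast
  \<comment> \<open>The four bounds put \<open>(x, 0)\<close> into \<open>U\<close> and
    \<open>x\<close> into the domain of the estimates for \<open>g\<close>, allow
    \<open>norm x ^ n\<close> to be replaced by the square, and put the first component of
    \<open>\<phi> (x, 0)\<close> into the domain for \<open>f\<close>. The halves give strict
    inequalities.\<close>
  define R where "R = min (min (\<rho> / 2) (rg / 2)) (min 1 (rf / (2 * L)))"
  have R: "R > 0" using \<rho> f.r_pos g.r_pos L by (simp add: R_def)
  have "(x, 0) \<in> U \<and> norm (snd (\<phi> (x, 0))) \<le> CARD('p) * (L * (2 * Cg)) * (norm x)\<^sup>2 \<and>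
    (\<forall>N. 0 \<le> N \<longrightarrow> (\<forall>v. norm (g' x v) \<le> N * norm v) \<longrightarrow>
      (\<forall>v. norm (f' (fst (\<phi> (x, 0))) v) \<le> L * N * norm v))" if "norm x \<le> R" for x
  proof -
    have x: "norm x < \<rho>" "norm x < rg" "norm x \<le> 1" "L * norm x < rf"
    proof -
      have "norm x \<le> \<rho> / 2" "norm x \<le> rg / 2" "norm x \<le> 1" "norm x \<le> rf / (2 * L)"
        using that by (auto simp: R_def)
      then show "norm x < \<rho>" "norm x < rg" "norm x \<le> 1" "L * norm x < rf"
        using \<rho>(1) g.r_pos f.r_pos L by (auto simp: field_simps)
    qed
    have inU: "(x, 0) \<in> U" using x(1) \<rho>(2) by (auto simp: norm_Pair)
    define a where "a = fst (\<phi> (x, 0))"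
    define c where "c = snd (\<phi> (x, 0))"
    have ac: "\<phi> (x, 0) = (a, c)" by (simp add: a_def c_def)
    have "norm (\<phi> (x, 0) - \<phi> 0) \<le> L * norm ((x, 0) - 0 :: ('k^'n) \<times> ('k^'p))"
      by (rule lip\<phi>[OF inU U(3)])
    then have "norm (a, c) \<le> L * norm x"
      by (simp add: ac U(4) norm_Pair)
    then have na: "norm a < rf"
      using norm_fst_le[of a c] x(4) by linarith
    have acV: "(a, c) \<in> V" and \<psi>ac: "\<psi> (a, c) = (x, 0)"
      using \<phi>[OF inU] by (simp_all add: ac)
    have eq': "f (fst w) + Qf (snd w) = g (fst (\<psi> w)) + Qg (snd (\<psi> w))" if "w \<in> V" for w
      using eq[of "\<psi> w"] \<psi>[OF that] by simp
    note transfer = sum_of_squares_gradient_transfer[OF Q f.f_deriv[OF na] g.f_deriv[OF x(2)] U(2) acV eq' \<psi>ac lip\<psi>[OF _ acV] _ less_imp_le[OF L]]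
    have g'b: "norm (g' x v) \<le> 2 * Cg * norm x ^ n * norm v" for v
      by (rule g.f'_bound[OF x(2,3)])
    have "norm c \<le> CARD('p) * (L * (2 * Cg * norm x ^ n))"
      by (rule transfer(2)[OF _ _ g'b]) (use g.C_pos in auto)
    also have "\<dots> \<le> CARD('p) * (L * (2 * Cg * (norm x)\<^sup>2))"
      using power_decreasing[OF n norm_ge_zero x(3)] L g.C_pos by (intro mult_left_mono) auto
    finally have "norm c \<le> CARD('p) * (L * (2 * Cg)) * (norm x)\<^sup>2" by (simp add: mult_ac)
    moreover have "norm (f' a v) \<le> L * N * norm v" if "0 \<le> N" "\<forall>v. norm (g' x v) \<le> N * norm v" for N v
      by (rule transfer(1)) (use that in auto)
    ultimately show ?thesis using inU by (simp add: a_def c_def)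
  qed
  then show ?thesis using R by blast
qed

text \<open>
  In the application, \<open>a x\<close> and \<open>b x\<close> are the first components of \<open>\<phi> (x, 0)\<close> and \<open>\<phi>\<^sup>-\<^sup>1 (x, 0)\<close>. They are
  only inverse up to second order, as \<open>\<phi>\<close> need not preserve the subspace \<open>y = 0\<close>.
\<close>

definition gradient_bilip ::
  "('a::real_normed_vector \<Rightarrow> 'a \<Rightarrow> 'b::real_normed_vector) \<Rightarrow> ('a \<Rightarrow> 'a \<Rightarrow> 'b) \<Rightarrow> ('a \<Rightarrow> 'a) \<Rightarrow> ('a \<Rightarrow> 'a) \<Rightarrow> real \<Rightarrow> real \<Rightarrow> real \<Rightarrow> bool" where
  "gradient_bilip f' g' a b R L K \<longleftrightarrow> 
     a 0 = 0 \<and> (\<forall>x y. norm x \<le> R \<longrightarrow> norm y \<le> R \<longrightarrow> norm (a x - a y) \<le> L * norm (x - y)) \<and>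
     (\<forall>x. norm x \<le> R \<longrightarrow> norm (b (a x) - x) \<le> K * (norm x)\<^sup>2) \<and>
     (\<forall>x N. norm x \<le> R \<longrightarrow> 0 \<le> N \<longrightarrow> (\<forall>v. norm (g' x v) \<le> N * norm v) \<longrightarrow>
       (\<forall>v. norm (f' (a x) v) \<le> L * N * norm v))"

lemma gradient_bilip_mono:
  assumes "gradient_bilip f' g' a b R L K" "R' \<le> R" "K \<le> K'"
  shows "gradient_bilip f' g' a b R' L K'"
proof -
  have "norm (b (a x) - x) \<le> K' * (norm x)\<^sup>2" if "norm x \<le> R'" for x
    using assms that order_trans[OF _ mult_right_mono[OF assms(3), of "(norm x)\<^sup>2"], of "norm (b (a x) - x)"]
    unfolding gradient_bilip_def by simp
  then show ?thesis
    using assms(1,2) order_trans[OF _ assms(2)] unfolding gradient_bilip_def by simp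
qed

text \<open>With \<open>\<phi> (x, 0) = (a, c)\<close>, going back from \<open>(a, 0)\<close>
  instead of \<open>(a, c)\<close> changes the value of \<open>\<psi>\<close> by at most
  \<open>L * norm c\<close>, which is of second order; and
  \<open>\<psi> (a, c) = (x, 0)\<close>.\<close>

lemma sum_of_squares_gradient_bilip_half:
  fixes f g :: "'k::{real_normed_field,euclidean_space}^'n \<Rightarrow> 'k" and Qf Qg :: "'k^'p \<Rightarrow> 'k"
    and \<phi> :: "('k^'n) \<times> ('k^'p) \<Rightarrow> ('k^'n) \<times> ('k^'p)"
  assumes Q: "signed_sum_of_squares Qf" "signed_sum_of_squares Qg"
    and f: "leading_form f Hf f' Hf' m rf Cf" and g: "leading_form g Hg g' Hg' n rg Cg" and n: "2 \<le> n"
    and pair: "bilip_pair U V \<phi> \<psi> L"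
    and eq: "\<And>z. z \<in> U \<Longrightarrow> f (fst (\<phi> z)) + Qf (snd (\<phi> z)) = g (fst z) + Qg (snd z)"
  shows "\<exists>R>0. \<exists>K. gradient_bilip f' g' (\<lambda>x. fst (\<phi> (x, 0))) (\<lambda>x. fst (\<psi> (x, 0))) R L K"
proof -
  have U: "open U" "open V" "0 \<in> U" "\<phi> 0 = 0" and L: "0 < L"
    and \<phi>: "\<And>z. z \<in> U \<Longrightarrow> \<phi> z \<in> V \<and> \<psi> (\<phi> z) = z"
    and lip\<phi>: "\<And>x y. x \<in> U \<Longrightarrow> y \<in> U \<Longrightarrow> norm (\<phi> x - \<phi> y) \<le> L * norm (x - y)"
    and lip\<psi>: "\<And>x y. x \<in> V \<Longrightarrow> y \<in> V \<Longrightarrow> norm (\<psi> x - \<psi> y) \<le> L * norm (x - y)"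
    using pair unfolding bilip_pair_def by blast+
  have zero: "((0 :: 'k^'n), (0 :: 'k^'p)) = 0" by (simp add: zero_prod_def)
  have norm_fst: "norm (fst z) \<le> norm z" for z :: "('k^'n) \<times> ('k^'p)"
    using norm_fst_le[of "fst z" "snd z"] by simp
  have "0 \<in> V" using \<phi>[OF U(3)] U(4) by simp
  then obtain \<rho> where \<rho>: "\<rho> > 0" "ball 0 \<rho> \<subseteq> V"
    using U(2) openE by blast
  obtain R0 K0 where R0: "R0 > 0" and sec: "\<And>x. norm x \<le> R0 \<Longrightarrow> (x, 0) \<in> U"
     "\<And>x. norm x \<le> R0 \<Longrightarrow> norm (snd (\<phi> (x, 0))) \<le> K0 * (norm x)\<^sup>2"
     "\<And>x N v. norm x \<le> R0 \<Longrightarrow> 0 \<le> N \<Longrightarrow> \<forall>v. norm (g' x v) \<le> N * norm v \<Longrightarrow>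
      norm (f' (fst (\<phi> (x, 0))) v) \<le> L * N * norm v"
    using sum_of_squares_section[OF Q f g n pair eq] by blast
  define R where "R = min R0 (\<rho> / (2 * L))"
  have R: "R > 0" "R \<le> R0" using R0 \<rho> L by (auto simp: R_def)
  have lip: "norm (\<phi> (x, 0) - \<phi> (y, 0)) \<le> L * norm (x - y)" if "norm x \<le> R" "norm y \<le> R" for x y
    using lip\<phi>[OF sec(1) sec(1), of x y] that R(2) by (simp add: norm_Pair)
  have inv: "norm (fst (\<psi> (fst (\<phi> (x, 0)), 0)) - x) \<le> L * K0 * (norm x)\<^sup>2" if "norm x \<le> R" for x
  proof -
    obtain a c where ac: "\<phi> (x, 0) = (a, c)" by (cases "\<phi> (x, 0)")
    have "norm (a, c) \<le> L * norm x"
      using lip[OF that, of 0] R(1) by (simp add: zero U(4) ac)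
    moreover have "L * norm x < \<rho>" 
    proof -
      have "norm x \<le> \<rho> / (2 * L)" using that by (simp add: R_def)
      then show ?thesis using \<rho>(1) L by (simp add: field_simps)
    qed
    ultimately have "norm a < \<rho>" using norm_fst_le[of a c] by linarith
    then have a0: "(a, 0) \<in> V" using \<rho>(2) by (auto simp: norm_Pair)
    have inU: "(x, 0) \<in> U" using sec(1) that R(2) by simp
    have acV: "(a, c) \<in> V" "\<psi> (a, c) = (x, 0)" using \<phi>[OF inU] by (simp_all add: ac)
    have "norm (fst (\<psi> (a, 0)) - x) = norm (fst (\<psi> (a, 0) - \<psi> (a, c)))"
      by (simp add: acV(2))
    also have "\<dots> \<le> norm (\<psi> (a, 0) - \<psi> (a, c))"
      by (rule norm_fst)
    also have "\<dots> \<le> L * norm ((a, 0) - (a, c))" by (rule lip\<psi>[OF a0 acV(1)])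
    also have "\<dots> = L * norm c" by (simp add: norm_Pair)
    also have "\<dots> \<le> L * (K0 * (norm x)\<^sup>2)"
      using sec(2)[of x] that R(2) L by (intro mult_left_mono) (auto simp: ac)
    finally show ?thesis by (simp add: ac mult.assoc)
  qed
  have "gradient_bilip f' g' (\<lambda>x. fst (\<phi> (x, 0))) (\<lambda>x. fst (\<psi> (x, 0))) R L (L * K0)"
    unfolding gradient_bilip_def
  proof (intro conjI allI impI)
    show "fst (\<phi> (0, 0)) = 0" by (simp add: zero U(4))
    show "norm (fst (\<phi> (x, 0)) - fst (\<phi> (y, 0))) \<le> L * norm (x - y)" if "norm x \<le> R" "norm y \<le> R" for x y
      using order_trans[OF norm_fst lip[OF that]] by simp
    show "norm (fst (\<psi> (fst (\<phi> (x, 0)), 0)) - x) \<le> L * K0 * (norm x)\<^sup>2" if "norm x \<le> R" for x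
      by (rule inv[OF that])
    show "norm (f' (fst (\<phi> (x, 0))) v) \<le> L * N * norm v"
      if "norm x \<le> R" "0 \<le> N" "\<forall>v. norm (g' x v) \<le> N * norm v" for x N v
      by (rule sec(3)) (use that R(2) in auto)
  qed
  then show ?thesis using R(1) by blast
qed

lemma sum_of_squares_gradient_bilip:
  fixes f g :: "'k::{real_normed_field,euclidean_space}^'n \<Rightarrow> 'k" and Qf Qg :: "'k^'p \<Rightarrow> 'k"
  assumes Q: "signed_sum_of_squares Qf" "signed_sum_of_squares Qg"
    and f: "leading_form f Hf f' Hf' m rf Cf" and m: "2 \<le> m"
    and g: "leading_form g Hg g' Hg' n rg Cg" and n: "2 \<le> n"
    and equiv: "bilip_equiv_fun (\<lambda>(x, y). f x + Qf y) (\<lambda>(x, y). g x + Qg y)"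
  shows "\<exists>a b R L K. 0 < R \<and> 0 < L \<and> gradient_bilip f' g' a b R L K \<and> gradient_bilip g' f' b a R L K"
proof -
  obtain \<phi> U V where homeo: "bilip_homeo U V \<phi>"
    and eq: "\<And>z. z \<in> U \<Longrightarrow> f (fst (\<phi> z)) + Qf (snd (\<phi> z)) = g (fst z) + Qg (snd z)"
    using equiv unfolding bilip_equiv_fun_def case_prod_unfold by blast
  obtain \<psi> L where pair: "bilip_pair U V \<phi> \<psi> L"
    using bilip_homeo_imp_pair[OF homeo] .
  have eq': "g (fst (\<psi> w)) + Qg (snd (\<psi> w)) = f (fst w) + Qf (snd w)" if "w \<in> V" for w
    using eq[of "\<psi> w"] that pair unfolding bilip_pair_def by auto
  obtain R1 K1 where 1: "R1 > 0" "gradient_bilip f' g' (\<lambda>x. fst (\<phi> (x, 0))) (\<lambda>x. fst (\<psi> (x, 0))) R1 L K1"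
    using sum_of_squares_gradient_bilip_half[OF Q f g n pair eq] by blast
  obtain R2 K2 where 2: "R2 > 0" "gradient_bilip g' f' (\<lambda>x. fst (\<psi> (x, 0))) (\<lambda>x. fst (\<phi> (x, 0))) R2 L K2"
    using sum_of_squares_gradient_bilip_half[OF Q(2,1) g f m bilip_pair_sym[OF pair] eq'] by blast
  have "0 < L" using pair unfolding bilip_pair_def by blast
  moreover have "gradient_bilip f' g' (\<lambda>x. fst (\<phi> (x, 0))) (\<lambda>x. fst (\<psi> (x, 0))) (min R1 R2) L (max K1 K2)"
    by (rule gradient_bilip_mono[OF 1(2)]) auto
  moreover have "gradient_bilip g' f' (\<lambda>x. fst (\<psi> (x, 0))) (\<lambda>x. fst (\<phi> (x, 0))) (min R1 R2) L (max K1 K2)"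
    by (rule gradient_bilip_mono[OF 2(2)]) auto
  moreover have "0 < min R1 R2" using 1(1) 2(1) by simp
  ultimately show ?thesis by blast
qed

text \<open>Serves the case without \<open>y\<close>-variables, which the nonempty index type cannot
  express: the same \<open>Q\<close> is added on both sides and \<open>\<phi>\<close> is extended by
  the identity.\<close>

lemma bilip_equiv_fun_suspension:
  fixes f g :: "'a::euclidean_space \<Rightarrow> 'k::real_normed_field" and Q :: "'c::euclidean_space \<Rightarrow> 'k"
  assumes "bilip_equiv_fun f g"
  shows "bilip_equiv_fun (\<lambda>(x, y). f x + Q y) (\<lambda>(x, y). g x + Q y)"
proof -
  obtain \<phi> U V where homeo: "bilip_homeo U V \<phi>" and eq: "\<And>z. z \<in> U \<Longrightarrow> f (\<phi> z) = g z"
    using assms unfolding bilip_equiv_fun_def by blast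
  obtain \<psi> L where pair: "bilip_pair U V \<phi> \<psi> L"
    using bilip_homeo_imp_pair[OF homeo] .
  have prod_lip: "norm (map_prod h id x - map_prod h id y) \<le> (L + 1) * norm (x - y)"
    if "norm (h (fst x) - h (fst y)) \<le> L * norm (fst x - fst y)" "L > 0"
    for h :: "'a \<Rightarrow> 'a" and x y :: "'a \<times> 'c"
  proof -
    have "norm (map_prod h id x - map_prod h id y) \<le> norm (h (fst x) - h (fst y)) + norm (snd x - snd y)"
      by (cases x, cases y) (simp add: norm_Pair sqrt_sum_squares_le_sum)
    also have "\<dots> \<le> L * norm (x - y) + norm (x - y)"
    proof (rule add_mono)
      have "norm (fst x - fst y) \<le> norm (x - y)" "norm (snd x - snd y) \<le> norm (x - y)"
        using norm_fst_le[of "fst x - fst y" "snd x - snd y"] norm_snd_le[of "snd x - snd y" "fst x - fst y"]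
        by (cases x, cases y, simp)+
      then show "norm (h (fst x) - h (fst y)) \<le> L * norm (x - y)" "norm (snd x - snd y) \<le> norm (x - y)"
        using that by (auto intro: order_trans mult_left_mono)
    qed
    finally show ?thesis by (simp add: algebra_simps)
  qed
  have "bilip_pair (U \<times> UNIV) (V \<times> UNIV) (map_prod \<phi> id) (map_prod \<psi> id :: 'a \<times> 'c \<Rightarrow> 'a \<times> 'c) (L + 1)"
    using pair prod_lip[of \<phi>] prod_lip[of \<psi>] unfolding bilip_pair_def
    by (auto simp: open_Times zero_prod_def)
  then have "bilip_homeo (U \<times> UNIV) (V \<times> UNIV) (map_prod \<phi> id :: 'a \<times> 'c \<Rightarrow> 'a \<times> 'c)"
    by (rule bilip_pair_imp_homeo)
  then show ?thesis
    unfolding bilip_equiv_fun_def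
    by (intro exI[of _ "map_prod \<phi> id"] exI[of _ "U \<times> UNIV"] exI[of _ "V \<times> UNIV"]) (auto simp: eq)
qed

section \<open>Blow-up\<close>

lemma blowup_limit:
  fixes a b :: "'a::euclidean_space \<Rightarrow> 'a"
  assumes R: "0 < R" and L: "0 < L"
    and ab: "gradient_bilip f' g' a b R L K" and ba: "gradient_bilip g' f' b a R L K"
  obtains t :: "nat \<Rightarrow> real" and A B :: "'a \<Rightarrow> 'a"
  where "\<forall>n. 0 < t n \<and> t n \<le> R" "t \<longlonglongrightarrow> 0"
    "\<forall>x. norm x \<le> 1 \<longrightarrow> (\<lambda>n. a (t n *\<^sub>R x) /\<^sub>R t n) \<longlonglongrightarrow> A x"
    "\<forall>x. norm x \<le> 1 \<longrightarrow> (\<lambda>n. b (t n *\<^sub>R x) /\<^sub>R t n) \<longlonglongrightarrow> B x"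
proof -
  \<comment> \<open>The factor \<open>R\<close> keeps the rescaled unit ball inside the ball of
    radius \<open>R\<close>, where the Lipschitz bounds hold.\<close>
  define t0 where "t0 n = R * inverse (real (Suc n))" for n
  have t0: "0 < t0 n" "t0 n \<le> R" for n
  proof -
    show "0 < t0 n" using R by (simp add: t0_def)
    have "inverse (real (Suc n)) \<le> 1" by (simp add: inverse_le_1_iff)
    from mult_left_mono[OF this, of R] R show "t0 n \<le> R" by (simp add: t0_def)
  qed
  have t0_lim: "t0 \<longlonglongrightarrow> 0"
    unfolding t0_def using tendsto_mult_right_zero[OF LIMSEQ_inverse_real_of_nat] by simp
  \<comment> \<open>Both rescalings form one map into a product, so that a single subsequence serves
    \<open>a\<close> and \<open>b\<close> and their limits can be composed.\<close>
  define F where "F n x = (a (t0 n *\<^sub>R x) /\<^sub>R t0 n, b (t0 n *\<^sub>R x) /\<^sub>R t0 n)" for n x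
  have lip: "norm (h (t0 n *\<^sub>R x) /\<^sub>R t0 n - h (t0 n *\<^sub>R y) /\<^sub>R t0 n) \<le> L * norm (x - y)"
    if "norm x \<le> 1" "norm y \<le> 1" "h = a \<or> h = b" for n x y h
  proof -
    have dom: "norm (t0 n *\<^sub>R z) \<le> R" if "norm z \<le> 1" for z :: 'a
      using t0[of n] that mult_mono[of "t0 n" R "norm z" 1] by simp
    have "norm (h (t0 n *\<^sub>R x) - h (t0 n *\<^sub>R y)) \<le> L * norm (t0 n *\<^sub>R x - t0 n *\<^sub>R y)"
      using ab ba that(3) dom[OF that(1)] dom[OF that(2)] unfolding gradient_bilip_def by blast
    also have "\<dots> = t0 n * (L * norm (x - y))"
      using t0(1)[of n] by (simp flip: scaleR_diff_right)
    finally have "norm (h (t0 n *\<^sub>R x) - h (t0 n *\<^sub>R y)) / t0 n \<le> L * norm (x - y)"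
      using t0(1)[of n] by (simp add: pos_divide_le_eq mult.commute)
    then show ?thesis
      using t0(1)[of n] by (simp add: divide_inverse_commute flip: scaleR_diff_right)
  qed
  have Flip: "norm (F n x - F n y) \<le> (2 * L) * norm (x - y)" if "norm x \<le> 1" "norm y \<le> 1" for n x y
  proof -
    have "norm (F n x - F n y) \<le> norm (a (t0 n *\<^sub>R x) /\<^sub>R t0 n - a (t0 n *\<^sub>R y) /\<^sub>R t0 n)
        + norm (b (t0 n *\<^sub>R x) /\<^sub>R t0 n - b (t0 n *\<^sub>R y) /\<^sub>R t0 n)"
      unfolding F_def by (simp add: norm_Pair sqrt_sum_squares_le_sum)
    also have "\<dots> \<le> L * norm (x - y) + L * norm (x - y)"
      by (intro add_mono lip that) auto
    finally show ?thesis by simp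
  qed
  have F0: "F n 0 = 0" for n
    using ab ba unfolding gradient_bilip_def F_def by (simp add: zero_prod_def)
  obtain h k where "continuous_on (cball 0 1) h" and k: "strict_mono (k :: nat \<Rightarrow> nat)"
    and h: "\<And>e. 0 < e \<Longrightarrow> \<exists>N. \<forall>n x. n \<ge> N \<and> x \<in> cball 0 1 \<longrightarrow> norm (F (k n) x - h x) < e"
  proof (rule Arzela_Ascoli[of "cball 0 1" F "2 * L"])
    show "compact (cball 0 1 :: 'a set)" by simp
    show "norm (F n x) \<le> 2 * L" if "x \<in> cball 0 1" for n x
    proof -
      have "norm (F n x) \<le> 2 * L * norm x" using Flip[of x 0 n] that by (simp add: F0)
      also have "\<dots> \<le> 2 * L * 1" using that L by (intro mult_left_mono) auto
      finally show ?thesis by simp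
    qed
    show "\<exists>d>0. \<forall>n y. y \<in> cball 0 1 \<and> norm (x - y) < d \<longrightarrow> norm (F n x - F n y) < e"
      if "x \<in> cball 0 1" "0 < e" for x e
    proof (intro exI[of _ "e / (2 * L)"] conjI allI impI)
      show "0 < e / (2 * L)" using that L by simp
      fix n y assume "y \<in> cball 0 1 \<and> norm (x - y) < e / (2 * L)"
      then have y: "norm y \<le> 1" "2 * L * norm (x - y) < e"
        using L by (auto simp: field_simps)
      then show "norm (F n x - F n y) < e"
        using Flip[of x y n] that by simp
    qed
  qed blast
  have lim: "(\<lambda>n. F (k n) x) \<longlonglongrightarrow> h x" if "norm x \<le> 1" for x
    using h that by (fastforce simp: LIMSEQ_iff)
  show thesis
  proof (rule that[of "t0 \<circ> k" "\<lambda>x. fst (h x)" "\<lambda>x. snd (h x)"])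
    show "(t0 \<circ> k) \<longlonglongrightarrow> 0" by (rule LIMSEQ_subseq_LIMSEQ[OF t0_lim k])
    show "\<forall>x. norm x \<le> 1 \<longrightarrow> (\<lambda>n. a ((t0 \<circ> k) n *\<^sub>R x) /\<^sub>R (t0 \<circ> k) n) \<longlonglongrightarrow> fst (h x)"
      using tendsto_fst[OF lim] by (simp add: F_def)
    show "\<forall>x. norm x \<le> 1 \<longrightarrow> (\<lambda>n. b ((t0 \<circ> k) n *\<^sub>R x) /\<^sub>R (t0 \<circ> k) n) \<longlonglongrightarrow> snd (h x)"
      using tendsto_snd[OF lim] by (simp add: F_def)
  qed (use t0 in auto)
qed

text \<open>The distance of \<open>b (t n *\<^sub>R y)\<close> from
  \<open>b (a (t n *\<^sub>R x))\<close> is at most \<open>L * t n\<close> times a null sequence,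
  and the latter differs from \<open>t n *\<^sub>R x\<close> by a multiple of the square of
  \<open>t n\<close>. Both errors vanish after division by \<open>t n\<close>.\<close>

lemma blowup_limit_inverse:
  fixes a b :: "'a::euclidean_space \<Rightarrow> 'a"
  assumes ab: "gradient_bilip f' g' a b R L K" and ba: "gradient_bilip g' f' b a R L K"
    and t: "\<And>n. 0 < t n" "\<And>n. t n \<le> R" "t \<longlonglongrightarrow> 0"
    and A: "(\<lambda>n. a (t n *\<^sub>R x) /\<^sub>R t n) \<longlonglongrightarrow> y"
    and B: "(\<lambda>n. b (t n *\<^sub>R y) /\<^sub>R t n) \<longlonglongrightarrow> z"
    and xy: "norm x \<le> 1" "norm y \<le> 1" and R: "0 < R"
  shows "z = x"
proof -
  have dom: "norm (t n *\<^sub>R u) \<le> R" if "norm u \<le> 1" for u :: 'a and n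
    using t(1,2)[of n] that mult_mono[of "t n" R "norm u" 1] R by simp
  have "(\<lambda>n. t n *\<^sub>R (a (t n *\<^sub>R x) /\<^sub>R t n)) \<longlonglongrightarrow> 0 *\<^sub>R y"
    by (intro tendsto_intros t(3) A)
  then have "(\<lambda>n. a (t n *\<^sub>R x)) \<longlonglongrightarrow> 0"
    using t(1) by (simp add: less_imp_neq[symmetric])
  from order_tendstoD(2)[OF tendsto_norm[OF this], of R]
  have ev: "\<forall>\<^sub>F n in sequentially. norm (a (t n *\<^sub>R x)) < R" using R by simp
  have "(\<lambda>n. L * norm (a (t n *\<^sub>R x) /\<^sub>R t n - y) + K * (norm x)\<^sup>2 * t n) \<longlonglongrightarrow> L * norm (y - y) + K * (norm x)\<^sup>2 * 0"
    by (intro tendsto_intros A t(3))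
  then have lim0: "(\<lambda>n. L * norm (a (t n *\<^sub>R x) /\<^sub>R t n - y) + K * (norm x)\<^sup>2 * t n) \<longlonglongrightarrow> 0" by simp
  have "(\<lambda>n. b (t n *\<^sub>R y) /\<^sub>R t n - x) \<longlonglongrightarrow> 0"
  proof (rule Lim_null_comparison[OF _ lim0])
    show "\<forall>\<^sub>F n in sequentially. norm (b (t n *\<^sub>R y) /\<^sub>R t n - x)
        \<le> L * norm (a (t n *\<^sub>R x) /\<^sub>R t n - y) + K * (norm x)\<^sup>2 * t n"
      using ev
    proof eventually_elim
      case (elim n)
      have tn: "0 < t n" by (rule t(1))
      have 1: "norm (b (t n *\<^sub>R y) - b (a (t n *\<^sub>R x))) \<le> L * norm (t n *\<^sub>R y - a (t n *\<^sub>R x))"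
        using ba dom[OF xy(2)] elim unfolding gradient_bilip_def by (meson less_imp_le)
      have 2: "norm (b (a (t n *\<^sub>R x)) - t n *\<^sub>R x) \<le> K * (norm (t n *\<^sub>R x))\<^sup>2"
        using ab dom[OF xy(1)] unfolding gradient_bilip_def by blast
      have "t n *\<^sub>R (b (t n *\<^sub>R y) /\<^sub>R t n - x) = (b (t n *\<^sub>R y) - b (a (t n *\<^sub>R x))) + (b (a (t n *\<^sub>R x)) - t n *\<^sub>R x)"
        using tn by (simp add: scaleR_diff_right)
      then have "norm (t n *\<^sub>R (b (t n *\<^sub>R y) /\<^sub>R t n - x)) \<le> L * norm (t n *\<^sub>R y - a (t n *\<^sub>R x)) + K * (norm (t n *\<^sub>R x))\<^sup>2"
        using norm_triangle_mono[OF 1 2] by simp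
      moreover have "t n *\<^sub>R y - a (t n *\<^sub>R x) = - (t n *\<^sub>R (a (t n *\<^sub>R x) /\<^sub>R t n - y))"
        using tn by (simp add: scaleR_diff_right)
      ultimately have "t n * norm (b (t n *\<^sub>R y) /\<^sub>R t n - x)
          \<le> t n * (L * norm (a (t n *\<^sub>R x) /\<^sub>R t n - y) + K * (norm x)\<^sup>2 * t n)"
        using tn by (simp only: norm_minus_cancel norm_scaleR abs_of_pos)
          (simp add: power2_eq_square algebra_simps)
      then show ?case using tn by (simp only: mult_le_cancel_left_pos)
    qed
  qed
  then have "(\<lambda>n. b (t n *\<^sub>R y) /\<^sub>R t n) \<longlonglongrightarrow> x"
    by (simp only: LIM_zero_iff)
  with B show ?thesis by (rule LIMSEQ_unique)
qed

lemma blowup_limit_lipschitz: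
  fixes a b :: "'a::euclidean_space \<Rightarrow> 'a"
  assumes ab: "gradient_bilip f' g' a b R L K" and R: "0 < R"
    and t: "\<And>n. 0 < t n" "\<And>n. t n \<le> R"
    and lim: "(\<lambda>n. a (t n *\<^sub>R x) /\<^sub>R t n) \<longlonglongrightarrow> x'" "(\<lambda>n. a (t n *\<^sub>R y) /\<^sub>R t n) \<longlonglongrightarrow> y'"
    and xy: "norm x \<le> 1" "norm y \<le> 1"
  shows "norm (x' - y') \<le> L * norm (x - y)"
proof (rule tendsto_upperbound[OF tendsto_norm[OF tendsto_diff[OF lim]]])
  have "norm (a (t n *\<^sub>R x) /\<^sub>R t n - a (t n *\<^sub>R y) /\<^sub>R t n) \<le> L * norm (x - y)" for n
  proof -
    have dom: "norm (t n *\<^sub>R z) \<le> R" if "norm z \<le> 1" for z :: 'a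
      using t[of n] that mult_mono[of "t n" R "norm z" 1] R by simp
    have "norm (a (t n *\<^sub>R x) - a (t n *\<^sub>R y)) \<le> L * norm (t n *\<^sub>R x - t n *\<^sub>R y)"
      using ab dom[OF xy(1)] dom[OF xy(2)] unfolding gradient_bilip_def by blast
    also have "\<dots> = t n * (L * norm (x - y))"
      using t(1)[of n] by (simp flip: scaleR_diff_right)
    finally have "norm (a (t n *\<^sub>R x) - a (t n *\<^sub>R y)) / t n \<le> L * norm (x - y)"
      using t(1)[of n] by (simp add: pos_divide_le_eq mult.commute)
    then show ?thesis
      using t(1)[of n] by (simp add: divide_inverse_commute flip: scaleR_diff_right)
  qed
  then show "\<forall>\<^sub>F n in sequentially. norm (a (t n *\<^sub>R x) /\<^sub>R t n - a (t n *\<^sub>R y) /\<^sub>R t n) \<le> L * norm (x - y)"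
    by simp
qed simp

text \<open>A gradient of \<open>g\<close> of order \<open>Suc m\<close> along the ray through
  \<open>x\<close> forces the same order for \<open>f'\<close> at the image points. Its quotient by
  \<open>t n ^ m\<close> then tends to 0, but it also tends to the leading gradient at
  \<open>y\<close>.\<close>

lemma (in leading_form) blowup_vanishing:
  assumes ab: "gradient_bilip f' g' a b R L K" and L: "0 < L" and M: "0 \<le> M"
    and t: "\<And>n. 0 < t n" "\<And>n. t n \<le> R" "t \<longlonglongrightarrow> 0"
    and lim: "(\<lambda>n. a (t n *\<^sub>R x) /\<^sub>R t n) \<longlonglongrightarrow> y" and x: "norm x \<le> 1" and R: "0 < R"
    and bound: "\<forall>\<^sub>F n in sequentially. \<forall>v. norm (g' (t n *\<^sub>R x) v) \<le> M * t n ^ Suc m * norm v"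
  shows "H' y = (\<lambda>v. 0)"
proof
  fix v
  have conv: "(\<lambda>n. f' (a (t n *\<^sub>R x)) v /\<^sub>R t n ^ m) \<longlonglongrightarrow> H' y v"
    by (rule rescaled_derivative_tendsto[OF t(3) _ lim]) (simp add: t(1))
  have lim0: "(\<lambda>n. L * M * norm v * t n) \<longlonglongrightarrow> 0"
    by (rule tendsto_mult_right_zero[OF t(3)])
  have "(\<lambda>n. f' (a (t n *\<^sub>R x)) v /\<^sub>R t n ^ m) \<longlonglongrightarrow> 0"
  proof (rule Lim_null_comparison[OF _ lim0])
    show "\<forall>\<^sub>F n in sequentially. norm (f' (a (t n *\<^sub>R x)) v /\<^sub>R t n ^ m) \<le> L * M * norm v * t n"
      using bound
    proof eventually_elim
      case (elim n)
      have tn: "0 < t n" by (rule t(1))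
      have dom: "norm (t n *\<^sub>R x) \<le> R"
        using t(1,2)[of n] x mult_mono[of "t n" R "norm x" 1] R by simp
      have "norm (f' (a (t n *\<^sub>R x)) v) \<le> L * (M * t n ^ Suc m) * norm v"
        using ab dom elim M tn unfolding gradient_bilip_def by (simp del: power_Suc)
      then have "norm (f' (a (t n *\<^sub>R x)) v) / t n ^ m \<le> L * M * norm v * t n"
        using tn by (simp add: pos_divide_le_eq mult_ac)
      then show ?case using tn by (simp add: divide_inverse_commute)
    qed
  qed
  with conv show "H' y v = 0" by (rule LIMSEQ_unique)
qed

text \<open>One estimate serves both conclusions of the theorem. If \<open>m < n\<close>, the whole
  gradient has order at least \<open>Suc m\<close>; if \<open>m = n\<close> and \<open>x\<close> is
  singular for the lowest part, the leading term vanishes on the whole ray and only the remainder is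
  left.\<close>

lemma leading_form_scaled_bound:
  assumes g: "leading_form g Hg g' Hg' n rg Cg" and t: "t \<longlonglongrightarrow> 0" "\<And>k. 0 < t k" and x: "norm x \<le> 1"
    and vanish: "m < n \<or> m = n \<and> Hg' x = (\<lambda>v. 0)"
  shows "\<forall>\<^sub>F k in sequentially. \<forall>v. norm (g' (t k *\<^sub>R x) v) \<le> 2 * Cg * t k ^ Suc m * norm v"
proof -
  interpret g: leading_form g Hg g' Hg' n rg Cg by (rule g)
  have "\<forall>\<^sub>F k in sequentially. t k < min rg 1"
    by (rule order_tendstoD(2)[OF t(1)]) (use g.r_pos in simp)
  then show ?thesis
  proof eventually_elim
    case (elim k)
    have tk: "0 < t k" "t k < rg" "t k \<le> 1" using t(2)[of k] elim by auto
    have ntx: "norm (t k *\<^sub>R x) \<le> t k" using tk x by (simp add: mult_left_le)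
    have dom: "norm (t k *\<^sub>R x) < rg" "norm (t k *\<^sub>R x) \<le> 1" using ntx tk by linarith+
    have pow: "norm (t k *\<^sub>R x) ^ i \<le> t k ^ i" for i
      by (rule power_mono[OF ntx norm_ge_zero])
    show ?case
    proof
      fix v
      show "norm (g' (t k *\<^sub>R x) v) \<le> 2 * Cg * t k ^ Suc m * norm v"
      proof (cases "m < n")
        case True
        have "norm (g' (t k *\<^sub>R x) v) \<le> 2 * Cg * norm (t k *\<^sub>R x) ^ n * norm v"
          by (rule g.f'_bound[OF dom])
        also have "\<dots> \<le> 2 * Cg * t k ^ Suc m * norm v"
          using order_trans[OF pow power_decreasing[of "Suc m" n "t k"]] True tk g.C_pos
          by (intro mult_right_mono mult_left_mono) auto
        finally show ?thesis .
      next
        case False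
        with vanish have mn: "m = n" and H0: "Hg' x = (\<lambda>v. 0)" by auto
        have "norm (g' (t k *\<^sub>R x) v - Hg' (t k *\<^sub>R x) v) \<le> Cg * norm (t k *\<^sub>R x) ^ Suc n * norm v"
          by (rule g.approx[OF dom(1)])
        also have "\<dots> \<le> 2 * Cg * t k ^ Suc n * norm v"
          using pow[of "Suc n"] g.C_pos tk by (intro mult_right_mono mult_mono) auto
        finally show ?thesis by (simp add: g.H'_scaleR H0 mn del: power_Suc)
      qed
    qed
  qed
qed

lemma gradient_bilip_leading_forms:
  fixes a b :: "'a::euclidean_space \<Rightarrow> 'a"
  assumes f: "leading_form f Hf f' Hf' m rf Cf" and g: "leading_form g Hg g' Hg' n rg Cg"
    and R: "0 < R" and L: "0 < L"
    and ab: "gradient_bilip f' g' a b R L K" and ba: "gradient_bilip g' f' b a R L K"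
  shows "m = n" and "bilip_equiv_set (singular_set Hf) (singular_set Hg)"
proof -
  interpret f: leading_form f Hf f' Hf' m rf Cf by (rule f)
  interpret g: leading_form g Hg g' Hg' n rg Cg by (rule g)
  obtain t :: "nat \<Rightarrow> real" and A B :: "'a \<Rightarrow> 'a"
    where t_R: "\<forall>n. 0 < t n \<and> t n \<le> R" and t_lim: "t \<longlonglongrightarrow> 0"
    and A_lim: "\<forall>x. norm x \<le> 1 \<longrightarrow> (\<lambda>n. a (t n *\<^sub>R x) /\<^sub>R t n) \<longlonglongrightarrow> A x"
    and B_lim: "\<forall>x. norm x \<le> 1 \<longrightarrow> (\<lambda>n. b (t n *\<^sub>R x) /\<^sub>R t n) \<longlonglongrightarrow> B x"
    using blowup_limit[OF R L ab ba] .
  have t: "0 < t n" "t n \<le> R" "t \<longlonglongrightarrow> 0" for n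
    using t_R t_lim by auto
  have A: "(\<lambda>n. a (t n *\<^sub>R x) /\<^sub>R t n) \<longlonglongrightarrow> A x"
    and B: "(\<lambda>n. b (t n *\<^sub>R x) /\<^sub>R t n) \<longlonglongrightarrow> B x" if "norm x \<le> 1" for x
    using A_lim B_lim that by auto
  have BA: "B (A x) = x" if "norm x \<le> 1" "norm (A x) \<le> 1" for x
    by (rule blowup_limit_inverse[OF ab ba t A[OF that(1)] B[OF that(2)] that R])
  have AB: "A (B x) = x" if "norm x \<le> 1" "norm (B x) \<le> 1" for x
    by (rule blowup_limit_inverse[OF ba ab t B[OF that(1)] A[OF that(2)] that R])
  have lipA: "norm (A x - A y) \<le> L * norm (x - y)" if "norm x \<le> 1" "norm y \<le> 1" for x y
    by (rule blowup_limit_lipschitz[OF ab R t(1,2) A[OF that(1)] A[OF that(2)] that])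
  have lipB: "norm (B x - B y) \<le> L * norm (x - y)" if "norm x \<le> 1" "norm y \<le> 1" for x y
    by (rule blowup_limit_lipschitz[OF ba R t(1,2) B[OF that(1)] B[OF that(2)] that])
  have ab0: "a 0 = 0" "b 0 = 0"
    using ab ba unfolding gradient_bilip_def by auto
  have A0: "A 0 = 0"
    by (rule LIMSEQ_unique[OF A]) (simp_all add: ab0)
  have B0: "B 0 = 0"
    by (rule LIMSEQ_unique[OF B]) (simp_all add: ab0)
  \<comment> \<open>\<open>A\<close> and \<open>B\<close> are known to be inverse to each other only
    while argument and image lie in the unit ball. Imposing both conditions gives open sets that the
    two maps exchange.\<close>
  define U where "U = ball 0 1 \<inter> A -` ball 0 1"
  define V where "V = ball 0 1 \<inter> B -` ball 0 1"
  have "continuous_on (ball 0 1) A" "continuous_on (ball 0 1) B"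
    by (rule lipschitz_bound_continuous_on[of _ _ L]; use lipA lipB L in auto)+
  then have "open U" "open V"
    unfolding U_def V_def by (auto intro: continuous_open_preimage)
  then have pair: "bilip_pair U V A B L"
    unfolding bilip_pair_def using A0 L lipA lipB BA AB by (auto simp: U_def V_def)
  have AU: "A x \<in> V" if "x \<in> U" for x using pair that unfolding bilip_pair_def by blast
  have BV: "B x \<in> U" "A (B x) = x" if "x \<in> V" for x using pair that unfolding bilip_pair_def by blast+
  have U1: "norm x \<le> 1" if "x \<in> U" for x using that by (simp add: U_def)
  have V1: "norm x \<le> 1" if "x \<in> V" for x using that by (simp add: V_def)
  have 0: "0 \<in> U" "0 \<in> V" by (simp_all add: U_def V_def A0 B0)
  have van_f: "Hf' (A x) = (\<lambda>v. 0)" if "x \<in> U" "m < n \<or> m = n \<and> Hg' x = (\<lambda>v. 0)" for x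
    by (rule f.blowup_vanishing[OF ab L _ t A[OF U1[OF that(1)]] U1[OF that(1)] R
          leading_form_scaled_bound[OF g t(3,1) U1[OF that(1)] that(2)]]) (use g.C_pos in simp)
  have van_g: "Hg' (B x) = (\<lambda>v. 0)" if "x \<in> V" "n < m \<or> n = m \<and> Hf' x = (\<lambda>v. 0)" for x
    by (rule g.blowup_vanishing[OF ba L _ t B[OF V1[OF that(1)]] V1[OF that(1)] R
          leading_form_scaled_bound[OF f t(3,1) V1[OF that(1)] that(2)]]) (use f.C_pos in simp)
  have "\<not> m < n"
  proof
    assume "m < n"
    then have "Hf' x = (\<lambda>v. 0)" if "x \<in> V" for x
      using van_f[OF BV(1)[OF that]] BV(2)[OF that] by simp
    then show False using f.H'_nonzero_near_0[OF \<open>open V\<close> 0(2)] by blast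
  qed
  moreover have "\<not> n < m"
  proof
    assume "n < m"
    then have "Hg' x = (\<lambda>v. 0)" if "x \<in> U" for x
      using van_g[OF AU[OF that]] pair that unfolding bilip_pair_def by simp
    then show False using g.H'_nonzero_near_0[OF \<open>open U\<close> 0(1)] by blast
  qed
  ultimately show mn: "m = n" by simp
  \<comment> \<open>As \<open>F \<circ> \<phi> = G\<close>, the map \<open>A\<close> leads from the
    side of \<open>g\<close> to that of \<open>f\<close>; the required direction is that of its
    inverse \<open>B\<close>.\<close>
  have "B ` (singular_set Hf \<inter> V) = singular_set Hg \<inter> U"
  proof (intro equalityI subsetI)
    fix x assume "x \<in> B ` (singular_set Hf \<inter> V)"
    then obtain y where "x = B y" "y \<in> V" "Hf' y = (\<lambda>v. 0)"
      by (auto simp: f.mem_singular_set_iff)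
    then show "x \<in> singular_set Hg \<inter> U"
      using van_g[of y] mn BV(1) by (simp add: g.mem_singular_set_iff)
  next
    fix x assume "x \<in> singular_set Hg \<inter> U"
    then have x: "x \<in> U" "Hg' x = (\<lambda>v. 0)" by (auto simp: g.mem_singular_set_iff)
    then have "A x \<in> singular_set Hf \<inter> V" "x = B (A x)"
      using van_f[of x] mn AU pair unfolding bilip_pair_def by (auto simp: f.mem_singular_set_iff)
    then show "x \<in> B ` (singular_set Hf \<inter> V)" by blast
  qed
  then show "bilip_equiv_set (singular_set Hf) (singular_set Hg)"
    using bilip_pair_imp_homeo[OF bilip_pair_sym[OF pair]] unfolding bilip_equiv_set_def by blast
qed

lemma sum_of_squares_bilip_invariants:
  fixes f g :: "'k::{real_normed_field,euclidean_space}^'n \<Rightarrow> 'k" and Qf Qg :: "'k^'p \<Rightarrow> 'k"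
  assumes f: "open U" "0 \<in> U" "field_smooth_on U f" "finite_multiplicity f" "multiplicity_at_0 f \<ge> 3"
    and g: "open V" "0 \<in> V" "field_smooth_on V g" "finite_multiplicity g" "multiplicity_at_0 g \<ge> 3"
    and Q: "signed_sum_of_squares Qf" "signed_sum_of_squares Qg"
    and equiv: "bilip_equiv_fun (\<lambda>(x, y). f x + Qf y) (\<lambda>(x, y). g x + Qg y) \<or> bilip_equiv_fun f g"
  shows "multiplicity_at_0 f = multiplicity_at_0 g \<and>
    bilip_equiv_set (singular_set (lowest_part f)) (singular_set (lowest_part g))"
proof -
  obtain m n where mult: "multiplicity_at_0 f = Suc m" "multiplicity_at_0 g = Suc n"
    using f(5) g(5) by (cases "multiplicity_at_0 f"; cases "multiplicity_at_0 g") auto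
  then have mn: "2 \<le> m" "2 \<le> n" using f(5) g(5) by auto
  obtain f' Hf' rf Cf where lf: "leading_form f (lowest_part f) f' Hf' m rf Cf"
    using multiplicity_leading_form[OF f(1,3,2,4) mult(1)] by blast
  obtain g' Hg' rg Cg where lg: "leading_form g (lowest_part g) g' Hg' n rg Cg"
    using multiplicity_leading_form[OF g(1,3,2,4) mult(2)] by blast
  \<comment> \<open>If only \<open>f\<close> and \<open>g\<close> are known to be equivalent,
    \<open>Qf\<close> is added to both, so \<open>Q(1)\<close> occurs twice.\<close>
  have "\<exists>a b R L K. 0 < R \<and> 0 < L \<and> gradient_bilip f' g' a b R L K \<and> gradient_bilip g' f' b a R L K"
    using equiv sum_of_squares_gradient_bilip[OF Q lf mn(1) lg mn(2)]
      sum_of_squares_gradient_bilip[OF Q(1,1) lf mn(1) lg mn(2) bilip_equiv_fun_suspension]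
    by blast
  then obtain a b R L K where "0 < R" "0 < L"
    "gradient_bilip f' g' a b R L K" "gradient_bilip g' f' b a R L K"
    by blast
  from gradient_bilip_leading_forms[OF lf lg this] show ?thesis
    by (simp add: mult)
qed

(* The index type 'p is nonempty, so the first disjunct of each bi-Lipschitz hypothesis covers
   p >= 1; the second one is the case p = 0, where F = f and G = g. *)

theorem theorem5p1:
  shows
    "(\<forall>(f :: real^'n \<Rightarrow> real) g (Qf :: real^'p \<Rightarrow> real) Qg.
        real_smooth_germ f \<and> finite_multiplicity f \<and> multiplicity_at_0 f \<ge> 3 \<and>
        real_smooth_germ g \<and> finite_multiplicity g \<and> multiplicity_at_0 g \<ge> 3 \<and>
        signed_sum_of_squares Qf \<and> signed_sum_of_squares Qg \<and>
        (bilip_equiv_fun (\<lambda>(x, y). f x + Qf y) (\<lambda>(x, y). g x + Qg y) \<or> bilip_equiv_fun f g)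
      \<longrightarrow>
        multiplicity_at_0 f = multiplicity_at_0 g \<and>
        bilip_equiv_set (singular_set (lowest_part f)) (singular_set (lowest_part g)))
   \<and> (\<forall>(f :: complex^'n \<Rightarrow> complex) g (Qf :: complex^'p \<Rightarrow> complex) Qg.
        holomorphic_germ f \<and> finite_multiplicity f \<and> multiplicity_at_0 f \<ge> 3 \<and>
        holomorphic_germ g \<and> finite_multiplicity g \<and> multiplicity_at_0 g \<ge> 3 \<and>
        signed_sum_of_squares Qf \<and> signed_sum_of_squares Qg \<and>
        (bilip_equiv_fun (\<lambda>(x, y). f x + Qf y) (\<lambda>(x, y). g x + Qg y) \<or> bilip_equiv_fun f g)
      \<longrightarrow>
        multiplicity_at_0 f = multiplicity_at_0 g \<and>
        bilip_equiv_set (singular_set (lowest_part f)) (singular_set (lowest_part g)))"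
proof (intro conjI allI impI; elim conjE)
  fix f g :: "real^'n \<Rightarrow> real" and Qf Qg :: "real^'p \<Rightarrow> real"
  assume f: "real_smooth_germ f" "finite_multiplicity f" "multiplicity_at_0 f \<ge> 3"
    and g: "real_smooth_germ g" "finite_multiplicity g" "multiplicity_at_0 g \<ge> 3"
    and Q: "signed_sum_of_squares Qf" "signed_sum_of_squares Qg"
    and equiv: "bilip_equiv_fun (\<lambda>(x, y). f x + Qf y) (\<lambda>(x, y). g x + Qg y) \<or> bilip_equiv_fun f g"
  obtain U where U: "open U" "0 \<in> U" "field_smooth_on U f"
    using real_smooth_germ_field_smooth[OF f(1)] by blast
  obtain V where V: "open V" "0 \<in> V" "field_smooth_on V g"
    using real_smooth_germ_field_smooth[OF g(1)] by blast
  note inv = sum_of_squares_bilip_invariants[OF U f(2,3) V g(2,3) Q equiv]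
  show "multiplicity_at_0 f = multiplicity_at_0 g" using inv by blast
  show "bilip_equiv_set (singular_set (lowest_part f)) (singular_set (lowest_part g))" using inv by blast
next
  fix f g :: "complex^'n \<Rightarrow> complex" and Qf Qg :: "complex^'p \<Rightarrow> complex"
  assume f: "holomorphic_germ f" "finite_multiplicity f" "multiplicity_at_0 f \<ge> 3"
    and g: "holomorphic_germ g" "finite_multiplicity g" "multiplicity_at_0 g \<ge> 3"
    and Q: "signed_sum_of_squares Qf" "signed_sum_of_squares Qg"
    and equiv: "bilip_equiv_fun (\<lambda>(x, y). f x + Qf y) (\<lambda>(x, y). g x + Qg y) \<or> bilip_equiv_fun f g"
  obtain U where U: "open U" "0 \<in> U" "field_smooth_on U f"
    using holomorphic_germ_field_smooth[OF f(1)] by blast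
  obtain V where V: "open V" "0 \<in> V" "field_smooth_on V g"
    using holomorphic_germ_field_smooth[OF g(1)] by blast
  note inv = sum_of_squares_bilip_invariants[OF U f(2,3) V g(2,3) Q equiv]
  show "multiplicity_at_0 f = multiplicity_at_0 g" using inv by blast
  show "bilip_equiv_set (singular_set (lowest_part f)) (singular_set (lowest_part g))" using inv by blast
qed

end
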